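(* Let $[a,b]_{\mathbb{T}}$ be a time scale interval, $\boldsymbol{\varphi}=(\varphi_k)_{k=1}^\infty\in c_0$, and let $\mathbf{f}=(f_k)_{k=1}^\infty:[a,b]_{\mathbb{T}}\times K_{c_0}[\boldsymbol{\varphi},\beta]\to c_0$ for some $\beta>0$. Let $p_j\in C_{rd}([a,b]_{\mathbb{T}},\mathbb{R})$ be non-negative for $j=1,2,\dots$. Let $(n_j)_{j=1}^\infty\subseteq\mathbb{N}$ be a non-decreasing sequence such that $\lim_{j\to\infty}n_j=\infty$. Assume that (i) the family $\{\mathbf{f}(\cdot,\mathbf{x})\}_{\mathbf{x}\in K_{c_0}[\boldsymbol{\varphi},\beta]}$ is uniformly rd-equicontinuous on $[a,b]_{\mathbb{T}}$; (ii) the family $\{\mathbf{f}(t,\cdot)\}_{t\in[a,b]_{\mathbb{T}}}$ is uniformly equicontinuous on $K_{c_0}[\boldsymbol{\varphi},\beta]$; (iii) for some $Q>0$, $|f_j(t,\mathbf{x})|\le p_j(t)+Q\sup_{i\ge n_j}|x_i|$ for all $(t,\mathbf{x})\in[a,b]_{\mathbb{T}}\times K_{c_0}[\boldsymbol{\varphi},\beta]$ and all $j=1,2,\dots$; (iv) $\lim_{j\to\infty}p_j(t)=0$ for all $t\in[a,b]_{\mathbb{T}}$; (v) for some $P>0$, $p_j(t)\le P$ for all $t\in[a,b]_{\mathbb{T}}$ and all $j=1,2,\dots$. Then the initial value problem in the Banach space $c_0$ $$\mathbf{u}^{\Delta}(t)=\mathbf{f}(t,\mathbf{u}(t)),\quad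 t\in[a,b]_{\mathbb{T}}^{\kappa},\qquad \mathbf{u}(a)=\boldsymbol{\varphi},$$ has a local solution on $[a,\sigma(b^\star)]_{\mathbb{T}}$, where $b^\star\in[a,b]_{\mathbb{T}}$ is defined by $$b^{\star}:=\sup\left\{s\in\mathbb{T}:\ \sigma(s)\le\min\left\{b,\,a+\frac{\beta}{M}\right\}\right\},\qquad M:=P+Q\,(\|\boldsymbol{\varphi}\|_{c_0}+\beta).$$
   Context: $c_0$ is the Banach space of real sequences $\mathbf{x}=(x_k)_{k=1}^\infty$ with $x_k\to0$, with norm $\|\mathbf{x}\|_{c_0}=\sup_k|x_k|$. $K_{E}[x_0,r]$ is the closed ball in a Banach space $E$ with centre $x_0$ and radius $r$. Below $E$ is a real Banach space (here $E=c_0$ or $\mathbb{R}$). **Time scales.** A time scale $\mathbb{T}$ is a non-empty closed subset of $\mathbb{R}$ with the topology inherited from $\mathbb{R}$. For $a,b\in\mathbb{T}$, $[a,b]_{\mathbb{T}}:=[a,b]\cap\mathbb{T}$. The jump operators are $\sigma(t):=\inf\{s\in\mathbb{T}:s>t\}$ and $\rho(t):=\sup\{s\in\mathbb{T}:s<t\}$, with $\inf\emptyset:=\sup\mathbb{T}$, $\sup\emptyset:=\inf\mathbb{T}$. A point $t$ is right-dense if $\sigma(t)=t$, right-scattered if $\sigma(t)>t$, left-dense if $\rho(t)=t$, left-scattered if $\rho(t)<t$. $\mathbb{T}^\kappa$ is $\mathbb{T}$ with its maximum removed if $\mathbb{T}$ has a left-scattered maximum, and $\mathbb{T}^\kappa:=\mathbb{T}$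 otherwise. Convention: when working on an interval $[a,b]_{\mathbb{T}}$, it is treated as if it were the whole time scale $\mathbb{T}$; in particular $\sigma(b)=b$ (so $b$ is right-dense), and $\inf\mathbb T=a$. The same convention applies to a subinterval $[a,c]_{\mathbb{T}}$ when functions are considered on it. For $\delta>0$, $\mathcal{O}^{\delta}_{\mathbb{T}}(t):=(t-\delta,t+\delta)\cap\mathbb{T}$. **$\Delta$-derivative.** $u:\mathbb{T}\to E$ is $\Delta$-differentiable at $t$ with $\Delta$-derivative $u^\Delta(t)\in E$ if for every $\varepsilon>0$ there is $\delta>0$ such that $\|u(\sigma(t))-u(s)-(\sigma(t)-s)u^{\Delta}(t)\|_E\le\varepsilon|\sigma(t)-s|$ for all $s\in\mathcal{O}^{\delta}_{\mathbb{T}}(t)$. (It is unique for $t\in\mathbb{T}^\kappa$; at a left-scattered maximum every vector is a $\Delta$-derivative.) **rd-continuity.** $u:\mathbb{T}\to E$ is rd-continuous if it is continuous at all right-dense points and has (finite) left-sided limits at all left-dense points. $C([a,b]_{\mathbb{T}},E)$, $C_{rd}([a,b]_{\mathbb{T}},E)$ denote the continuous and rd-continuous functions. $C^1_{rd}([a,b]_{\mathbb{T}},E)$ is the set of $u\in C([a,b]_{\mathbb{T}},E)$ such that $u^\Delta$ exists on $[a,b]_{\mathbb{T}}$ and $u^\Delta\in C_{rd}([a,b]_{\mathbb{T}},E)$ (at a left-scattered maximum the choice of $u^\Delta$ is irrelevant). **Local solution.** A local solution on $[a,c]_{\mathbb{T}}\subseteq[a,b]_{\mathbb{T}}$ is $\mathbf{u}\in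 C^1_{rd}([a,c]_{\mathbb{T}},c_0)$ such that $\mathbf{u}^\Delta(t)=\mathbf{f}(t,\mathbf{u}(t))$ for all $t\in[a,c]_{\mathbb{T}}^\kappa$ (in particular $(t,\mathbf{u}(t))$ is in the domain of $\mathbf{f}$ for these $t$) and $\mathbf{u}(a)=\boldsymbol{\varphi}$. **Uniform (rd-)equicontinuity.** A family $Y$ of functions $[a,b]_{\mathbb{T}}\to E$ is uniformly rd-equicontinuous on $[a,b]_{\mathbb{T}}$ if for every $\varepsilon>0$ there exist $\delta_1,\dots,\delta_n>0$ and $\tau_1,\dots,\tau_n\in[a,b]_{\mathbb{T}}$ with $a=\tau_1<\dots<\tau_n=b$ and $[a,b]_{\mathbb{T}}\subseteq\bigcup_{i=1}^n\mathcal{O}^{\delta_i}_{\mathbb{T}}(\tau_i)$ such that for all $u\in Y$, all $j=1,\dots,n$ and all $s,t\in\mathcal{O}^{\delta_j}_{\mathbb{T}}(\tau_j)$: if ($\tau_j$ is right-dense, or $s,t<\tau_j$, or $s,t\ge\tau_j$), then $\|u(s)-u(t)\|_E<\varepsilon$. A family of functions on a set $D$ of a metric space is uniformly equicontinuous if for each $\varepsilon>0$ there is one $\delta>0$ such that for all members $g$ of the family and all $x,y\in D$ at distance less than $\delta$, $g(x)$ and $g(y)$ are at distance less than $\varepsilon$. *)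

theory Defs
  imports "HOL-Analysis.Analysis"
begin

section \<open>The Banach space of real null sequences\<close>

text \<open>
  Sequences are indexed by \<open>nat\<close>, starting at 0: the coordinate usually written \<open>x\<^sub>k\<close> for
  \<open>k \<ge> 1\<close> is \<open>coord x (k - 1)\<close>.
\<close>

typedef c0 = "{x :: nat \<Rightarrow> real. x \<longlonglongrightarrow> 0}"
  morphisms coord Abs_c0
  by (rule exI[of _ "\<lambda>_. 0"]) simp

setup_lifting type_definition_c0

lemma c0_eqI: "(\<And>k. coord x k = coord y k) \<Longrightarrow> x = y"
  by (simp add: coord_inject[symmetric] fun_eq_iff)

lemma coord_tendsto_0: "coord x \<longlonglongrightarrow> 0"
  using coord[of x] by simp

lemma coord_bdd_above: "bdd_above (range (\<lambda>k. \<bar>coord x k\<bar>))"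
proof -
  have "Bseq (coord x)"
    using coord_tendsto_0 convergentI convergent_imp_Bseq by blast
  then show ?thesis
    unfolding Bseq_def bdd_above_def by auto
qed

instantiation c0 :: real_vector
begin

lift_definition zero_c0 :: c0 is "\<lambda>_. 0"
  by simp

lift_definition plus_c0 :: "c0 \<Rightarrow> c0 \<Rightarrow> c0" is "\<lambda>x y k. x k + y k"
  using tendsto_add by fastforce

lift_definition minus_c0 :: "c0 \<Rightarrow> c0 \<Rightarrow> c0" is "\<lambda>x y k. x k - y k"
  using tendsto_diff by fastforce

lift_definition uminus_c0 :: "c0 \<Rightarrow> c0" is "\<lambda>x k. - x k"
  using tendsto_minus by fastforce

lift_definition scaleR_c0 :: "real \<Rightarrow> c0 \<Rightarrow> c0" is "\<lambda>r x k. r * x k"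
  using tendsto_mult_right_zero by blast

instance
proof
  fix x y z :: c0 and r s :: real
  show "x + y + z = x + (y + z)" by transfer (simp add: add.assoc)
  show "x + y = y + x" by transfer (simp add: add.commute)
  show "0 + x = x" by transfer simp
  show "- x + x = 0" by transfer simp
  show "x - y = x + - y" by transfer simp
  show "r *\<^sub>R (x + y) = r *\<^sub>R x + r *\<^sub>R y" by transfer (simp add: algebra_simps)
  show "(r + s) *\<^sub>R x = r *\<^sub>R x + s *\<^sub>R x" by transfer (simp add: algebra_simps)
  show "r *\<^sub>R s *\<^sub>R x = (r * s) *\<^sub>R x" by transfer (simp add: algebra_simps)
  show "1 *\<^sub>R x = x" by transfer simp
qed

end

instantiation c0 :: real_normed_vector
begin

definition norm_c0 :: "c0 \<Rightarrow> real"
  where "norm_c0 x = (SUP k. \<bar>coord x k\<bar>)"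

definition dist_c0 :: "c0 \<Rightarrow> c0 \<Rightarrow> real"
  where "dist_c0 x y = norm (x - y)"

definition sgn_c0 :: "c0 \<Rightarrow> c0"
  where "sgn_c0 x = x /\<^sub>R norm x"

definition uniformity_c0 :: "(c0 \<times> c0) filter"
  where "uniformity_c0 = (INF e\<in>{0<..}. principal {(x, y). dist x y < e})"

definition open_c0 :: "c0 set \<Rightarrow> bool"
  where "open_c0 U \<longleftrightarrow> (\<forall>x\<in>U. \<forall>\<^sub>F (x', y) in uniformity. x' = x \<longrightarrow> y \<in> U)"

instance
proof
  fix x y :: c0 and r :: real
  show "dist x y = norm (x - y)" by (rule dist_c0_def)
  show "sgn x = x /\<^sub>R norm x" by (rule sgn_c0_def)
  show "uniformity = (INF e\<in>{0<..}. principal {(x, y :: c0). dist x y < e})"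
    by (rule uniformity_c0_def)
  show "open U \<longleftrightarrow> (\<forall>x\<in>U. \<forall>\<^sub>F (x', y) in uniformity. x' = x \<longrightarrow> y \<in> U)" for U :: "c0 set"
    by (rule open_c0_def)
  have le: "\<bar>coord u k\<bar> \<le> norm u" for u k
    unfolding norm_c0_def by (rule cSUP_upper[OF UNIV_I coord_bdd_above])
  have leI: "norm u \<le> B" if "\<And>k. \<bar>coord u k\<bar> \<le> B" for u B
    unfolding norm_c0_def by (rule cSUP_least) (use that in auto)
  have nonneg: "0 \<le> norm u" for u :: c0
    using le[of u 0] by linarith
  show "norm x = 0 \<longleftrightarrow> x = 0"
  proof
    assume "norm x = 0"
    then have "coord x k = 0" for k using le[of x k] by simp
    then show "x = 0" by (intro c0_eqI) (simp add: zero_c0.rep_eq)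
  next
    assume "x = 0"
    then have "norm x \<le> 0" by (intro leI) (simp add: zero_c0.rep_eq)
    with nonneg[of x] show "norm x = 0" by simp
  qed
  show "norm (x + y) \<le> norm x + norm y"
  proof (rule leI)
    fix k
    show "\<bar>coord (x + y) k\<bar> \<le> norm x + norm y"
      using le[of x k] le[of y k] by (simp add: plus_c0.rep_eq)
  qed
  have scale: "norm (q *\<^sub>R u) \<le> \<bar>q\<bar> * norm u" for q :: real and u :: c0
    by (rule leI) (simp add: scaleR_c0.rep_eq abs_mult mult_left_mono le)
  show "norm (r *\<^sub>R x) = \<bar>r\<bar> * norm x"
  proof (cases "r = 0")
    case True
    then show ?thesis using scale[of r x] nonneg[of "r *\<^sub>R x"] by simp
  next
    case False
    have "norm x = norm (inverse r *\<^sub>R (r *\<^sub>R x))"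
      using False by simp
    also have "\<dots> \<le> \<bar>inverse r\<bar> * norm (r *\<^sub>R x)" by (rule scale)
    finally have "\<bar>r\<bar> * norm x \<le> \<bar>r\<bar> * (\<bar>inverse r\<bar> * norm (r *\<^sub>R x))"
      by (rule mult_left_mono) simp
    also have "\<dots> = norm (r *\<^sub>R x)" using False by (simp add: abs_inverse)
    finally show ?thesis using scale[of r x] by simp
  qed
qed

end

lemma abs_coord_le_norm: "\<bar>coord x k\<bar> \<le> norm x"
  unfolding norm_c0_def by (rule cSUP_upper[OF UNIV_I coord_bdd_above])

lemma norm_c0_leI: "(\<And>k. \<bar>coord x k\<bar> \<le> B) \<Longrightarrow> norm x \<le> B"
  unfolding norm_c0_def by (rule cSUP_least) auto

instance c0 :: banach
proof
  fix X :: "nat \<Rightarrow> c0"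
  assume X: "Cauchy X"
  have diff: "\<bar>coord x k - coord y k\<bar> \<le> dist x y" for x y k
    using abs_coord_le_norm[of "x - y" k] by (simp add: dist_norm minus_c0.rep_eq)
  have "Cauchy (\<lambda>n. coord (X n) k)" for k
  proof (rule metric_CauchyI)
    fix e :: real assume "0 < e"
    then obtain N where N: "\<And>m n. m \<ge> N \<Longrightarrow> n \<ge> N \<Longrightarrow> dist (X m) (X n) < e"
      using metric_CauchyD[OF X] by blast
    have "dist (coord (X m) k) (coord (X n) k) < e" if "m \<ge> N" "n \<ge> N" for m n
      using N[OF that] diff[of "X m" k "X n"] by (simp add: dist_real_def)
    then show "\<exists>N. \<forall>m\<ge>N. \<forall>n\<ge>N. dist (coord (X m) k) (coord (X n) k) < e" by blast
  qed
  then have "\<exists>l. (\<lambda>n. coord (X n) k) \<longlonglongrightarrow> l" for k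
    by (simp add: Cauchy_convergent_iff convergent_def)
  then obtain L where L: "\<And>k. (\<lambda>n. coord (X n) k) \<longlonglongrightarrow> L k" by metis
  have unif: "\<exists>N. \<forall>n\<ge>N. \<forall>k. \<bar>coord (X n) k - L k\<bar> \<le> e" if e: "0 < e" for e
  proof -
    obtain N where N: "\<And>m n. m \<ge> N \<Longrightarrow> n \<ge> N \<Longrightarrow> dist (X m) (X n) < e"
      using metric_CauchyD[OF X e] by blast
    have "\<bar>coord (X n) k - L k\<bar> \<le> e" if "n \<ge> N" for n k
    proof (rule Lim_bounded)
      show "(\<lambda>m. \<bar>coord (X n) k - coord (X m) k\<bar>) \<longlonglongrightarrow> \<bar>coord (X n) k - L k\<bar>"
        by (intro tendsto_intros L)
      show "\<forall>m\<ge>N. \<bar>coord (X n) k - coord (X m) k\<bar> \<le> e"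
        using N[OF that] diff[of "X n" k] by (meson less_imp_le order_trans)
    qed
    then show ?thesis by blast
  qed
  have L0: "L \<longlonglongrightarrow> 0"
  proof (rule LIMSEQ_I)
    fix e :: real assume "0 < e"
    then obtain n where n: "\<And>k. \<bar>coord (X n) k - L k\<bar> \<le> e / 2"
      using unif[of "e / 2"] by auto
    obtain K where K: "\<And>k. k \<ge> K \<Longrightarrow> \<bar>coord (X n) k\<bar> < e / 2"
      using LIMSEQ_D[OF coord_tendsto_0, of "e / 2" "X n"] \<open>0 < e\<close> by auto
    have "\<bar>L k\<bar> < e" if "k \<ge> K" for k
      using n[of k] K[OF that] by linarith
    then show "\<exists>K. \<forall>k\<ge>K. norm (L k - 0) < e" by auto
  qed
  have coordL: "coord (Abs_c0 L) = L"
    using L0 by (simp add: Abs_c0_inverse)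
  have "X \<longlonglongrightarrow> Abs_c0 L"
  proof (rule metric_LIMSEQ_I)
    fix e :: real assume "0 < e"
    then obtain N where N: "\<And>n k. n \<ge> N \<Longrightarrow> \<bar>coord (X n) k - L k\<bar> \<le> e / 2"
      using unif[of "e / 2"] by auto
    have "dist (X n) (Abs_c0 L) < e" if "n \<ge> N" for n
    proof -
      have "norm (X n - Abs_c0 L) \<le> e / 2"
        using N[OF that] by (intro norm_c0_leI) (simp only: minus_c0.rep_eq coordL)
      then show ?thesis using \<open>0 < e\<close> by (simp add: dist_norm)
    qed
    then show "\<exists>N. \<forall>n\<ge>N. dist (X n) (Abs_c0 L) < e" by blast
  qed
  then show "convergent X" by (rule convergentI)
qed


section \<open>Time scales\<close>

text \<open>
  Functions on a time scale \<open>T\<close> are total functions on \<open>real\<close> of which only the values on \<open>T\<close>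
  matter. All notions below take the time scale as a parameter; an interval of a time scale is
  itself passed as the time scale, so that for instance \<open>forward_jump\<close> fixes its right endpoint.
\<close>

definition time_scale :: "real set \<Rightarrow> bool"
  where "time_scale T \<longleftrightarrow> T \<noteq> {} \<and> closed T"

abbreviation ts_interval :: "real set \<Rightarrow> real \<Rightarrow> real \<Rightarrow> real set"
  where "ts_interval T a b \<equiv> {a..b} \<inter> T"

text \<open>
  Infimum and supremum of a subset \<open>S\<close> of \<open>T\<close>, with \<open>inf {} = sup T\<close> and \<open>sup {} = inf T\<close>. In
  the two jump operators the empty case only arises when \<open>T\<close> is bounded on the relevant side.
\<close>

definition ts_Inf :: "real set \<Rightarrow> real set \<Rightarrow> real"
  where "ts_Inf T S = (if S = {} then Sup T else Inf S)"

definition ts_Sup :: "real set \<Rightarrow> real set \<Rightarrow> real"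
  where "ts_Sup T S = (if S = {} then Inf T else Sup S)"

definition forward_jump :: "real set \<Rightarrow> real \<Rightarrow> real"
  where "forward_jump T t = ts_Inf T {s \<in> T. s > t}"

definition backward_jump :: "real set \<Rightarrow> real \<Rightarrow> real"
  where "backward_jump T t = ts_Sup T {s \<in> T. s < t}"

definition right_dense :: "real set \<Rightarrow> real \<Rightarrow> bool"
  where "right_dense T t \<longleftrightarrow> forward_jump T t = t"

definition left_dense :: "real set \<Rightarrow> real \<Rightarrow> bool"
  where "left_dense T t \<longleftrightarrow> backward_jump T t = t"

definition left_scattered :: "real set \<Rightarrow> real \<Rightarrow> bool"
  where "left_scattered T t \<longleftrightarrow> backward_jump T t < t"

definition ts_kappa :: "real set \<Rightarrow> real set"
  where "ts_kappa T = T - {m \<in> T. (\<forall>s\<in>T. s \<le> m) \<and> left_scattered T m}"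

definition ts_nbhd :: "real set \<Rightarrow> real \<Rightarrow> real \<Rightarrow> real set"
  where "ts_nbhd T \<delta> t = {t - \<delta><..<t + \<delta>} \<inter> T"

definition has_delta_derivative ::
  "real set \<Rightarrow> (real \<Rightarrow> 'e::real_normed_vector) \<Rightarrow> 'e \<Rightarrow> real \<Rightarrow> bool"
  where "has_delta_derivative T u d t \<longleftrightarrow>
    (\<forall>\<epsilon>>0. \<exists>\<delta>>0. \<forall>s\<in>ts_nbhd T \<delta> t.
      norm (u (forward_jump T t) - u s - (forward_jump T t - s) *\<^sub>R d)
        \<le> \<epsilon> * \<bar>forward_jump T t - s\<bar>)"

text \<open>
  At a left-dense minimum of \<open>T\<close> the filter below is trivial and the left limit exists vacuously.
\<close>

definition rd_continuous :: "real set \<Rightarrow> (real \<Rightarrow> 'e::real_normed_vector) \<Rightarrow> bool"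
  where "rd_continuous T u \<longleftrightarrow>
    (\<forall>t\<in>T. (right_dense T t \<longrightarrow> continuous (at t within T) u) \<and>
           (left_dense T t \<longrightarrow> (\<exists>l. (u \<longlongrightarrow> l) (at t within (T \<inter> {..<t})))))"

definition C1_rd :: "real set \<Rightarrow> (real \<Rightarrow> 'e::real_normed_vector) set"
  where "C1_rd T = {u. continuous_on T u \<and>
    (\<exists>v. (\<forall>t\<in>T. has_delta_derivative T u (v t) t) \<and> rd_continuous T v)}"

text \<open>
  Solution on the whole time scale \<open>T\<close>, with initial time \<open>a\<close>, of the initial value problem for a
  right-hand side whose domain in the second argument is \<open>D\<close>.
\<close>

definition ivp_solution ::
  "real set \<Rightarrow> real \<Rightarrow> 'e::real_normed_vector set \<Rightarrow> 'e \<Rightarrow> (real \<Rightarrow> 'e \<Rightarrow> 'e) \<Rightarrow> (real \<Rightarrow> 'e) \<Rightarrow> bool"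
  where "ivp_solution T a D \<phi> f u \<longleftrightarrow>
    u \<in> C1_rd T \<and>
    (\<forall>t\<in>ts_kappa T. u t \<in> D \<and> has_delta_derivative T u (f t (u t)) t) \<and>
    u a = \<phi>"

definition uniformly_rd_equicontinuous ::
  "real set \<Rightarrow> real \<Rightarrow> real \<Rightarrow> (real \<Rightarrow> 'e::real_normed_vector) set \<Rightarrow> bool"
  where "uniformly_rd_equicontinuous T a b Y \<longleftrightarrow>
    (let I = ts_interval T a b in
      \<forall>\<epsilon>>0. \<exists>(n::nat) \<delta> \<tau>.
        1 \<le> n \<and> (\<forall>i\<in>{1..n}. 0 < \<delta> i \<and> \<tau> i \<in> I) \<and>
        \<tau> 1 = a \<and> \<tau> n = b \<and> strict_mono_on {1..n} \<tau> \<and>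
        I \<subseteq> (\<Union>i\<in>{1..n}. ts_nbhd I (\<delta> i) (\<tau> i)) \<and>
        (\<forall>u\<in>Y. \<forall>j\<in>{1..n}. \<forall>s\<in>ts_nbhd I (\<delta> j) (\<tau> j). \<forall>t\<in>ts_nbhd I (\<delta> j) (\<tau> j).
          right_dense I (\<tau> j) \<or> (s < \<tau> j \<and> t < \<tau> j) \<or> (\<tau> j \<le> s \<and> \<tau> j \<le> t)
            \<longrightarrow> norm (u s - u t) < \<epsilon>))"

definition uniformly_equicontinuous_on ::
  "'a::metric_space set \<Rightarrow> ('a \<Rightarrow> 'b::metric_space) set \<Rightarrow> bool"
  where "uniformly_equicontinuous_on D Y \<longleftrightarrow>
    (\<forall>\<epsilon>>0. \<exists>\<delta>>0. \<forall>g\<in>Y. \<forall>x\<in>D. \<forall>y\<in>D. dist x y < \<delta> \<longrightarrow> dist (g x) (g y) < \<epsilon>)"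

end

(*
  Euler polygons on K = [a, \<sigma>(b\<^sup>\<star>)] are kept inside the tube |x - \<phi>| \<le> M (t - a),
  |x_i| \<le> Y_i exp (2Q (t - a)). Here Y is a null sequence solving Y_j = E_j + Y_(n_j) / 2, where E
  dominates the tails of \<phi> and the inhomogeneous part of the growth bound (iii); with this choice
  an Euler step never leaves the tube. The tube is relatively compact in c0 and the polygons are
  equi-Lipschitz, so a subsequence converges pointwise. The Delta-integral equation is replaced by
  a mean value inequality: if f(., u) stays within R of a vector z on [s, t), then u(t) - u(s) is
  within (t - s) R of (t - s) z. Euler polygons satisfy it up to a vanishing error, and locally it
  passes to pointwise limits, where it yields the Delta-derivative.
*)

theory Submission
  imports Defs "HOL-Complex_Analysis.Great_Picard"
begin

section \<open>Null sequences\<close>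

text \<open>Continuity of the right-hand side alone gives no solutions in an infinite-dimensional
  space such as c0, where balls are not compact; compactness has to be extracted from (iii). There
  coordinate \<open>j\<close> is controlled by the tail from \<open>n j\<close>, which may start
  long before \<open>j\<close>, so the barrier has to absorb \<open>Y (n j)\<close>. With growth
  rate \<open>2 * Q\<close> the recursion for \<open>Y\<close> bounds coordinate \<open>j\<close> of
  \<open>f\<close> on the tube by \<open>2 * Q * Y j * exp (2 * Q * (t - a))\<close>, the derivative
  of the barrier itself, and the weight 1/2 makes the series that defines \<open>Y\<close> converge
  whatever \<open>n\<close> is. The other obstacle is the endpoint:
  \<open>\<sigma>(b\<^sup>\<star>)\<close> may exceed \<open>a + \<beta> / M\<close>, and then the
  solution may be outside the ball there. Such an endpoint is an isolated maximum, so states are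
  required to lie in the domain only on \<open>ts_kappa\<close>, and estimates along a step from
  \<open>s\<close> to \<open>t\<close> leave out \<open>t\<close>. The half-open form also suits
  rd-continuity: near a point where \<open>f\<close> jumps in time, steps can be made to end or
  start there.\<close>

lemma antimono_delay_majorant:
  fixes E :: "nat \<Rightarrow> real" and n :: "nat \<Rightarrow> nat"
  assumes anti: "antimono E" and E0: "E \<longlonglongrightarrow> 0"
    and n: "mono n" "filterlim n at_top sequentially"
  obtains Y where "antimono Y" "Y \<longlonglongrightarrow> 0" "\<And>j. Y j = E j + Y (n j) / 2" "\<And>j. E j \<le> Y j"
proof -
  have nonneg: "0 \<le> E j" for j
    by (rule decseq_ge[OF anti E0])
  have le0: "E j \<le> E 0" for j
    using anti by (simp add: antimono_def)
  \<comment> \<open>Iterating \<open>Y j = E j + Y (n j) / 2\<close> leads to this series, which a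
    geometric series dominates.\<close>
  define g where "g j m = (1/2)^m * E ((n ^^ m) j)" for j m
  have summ: "summable (g j)" for j
  proof (rule summable_comparison_test')
    show "summable (\<lambda>m. (1/2)^m * E 0)"
      by (intro summable_mult2 summable_geometric) auto
    show "norm (g j m) \<le> (1/2)^m * E 0" if "0 \<le> m" for m
      unfolding g_def using nonneg le0 by (simp add: abs_mult mult_left_mono divide_right_mono)
  qed
  define Y where "Y j = suminf (g j)" for j
  have rec: "Y j = E j + Y (n j) / 2" for j
  proof -
    have eq: "g j (Suc m) = g (n j) m / 2" for m
      by (simp add: g_def funpow_Suc_right del: funpow.simps)
    have "(\<Sum>m. g j (Suc m)) = Y (n j) / 2"
      unfolding eq Y_def by (rule suminf_divide[OF summ])
    moreover have "g j 0 = E j" by (simp add: g_def)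
    ultimately show ?thesis
      using suminf_split_head[OF summ[of j]] by (simp add: Y_def)
  qed
  have mono_pow: "(n ^^ m) i \<le> (n ^^ m) j" if "i \<le> j" for i j m
    using that n(1) by (induction m) (auto simp: mono_def)
  have antiY: "antimono Y"
  proof (rule antimonoI)
    fix i j :: nat assume "i \<le> j"
    then show "Y j \<le> Y i"
      unfolding Y_def g_def using summ anti mono_pow
      by (intro suminf_le) (auto simp: g_def[abs_def] antimono_def intro!: mult_left_mono divide_right_mono)
  qed
  have Ynn: "0 \<le> Y j" for j
    unfolding Y_def by (rule suminf_nonneg[OF summ]) (simp add: g_def nonneg)
  obtain L where L: "Y \<longlonglongrightarrow> L"
    using decseq_convergent[OF antiY, of 0] Ynn by blast
  \<comment> \<open>The limit is identified through the recursion rather than the series: since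
    \<open>n j\<close> tends to infinity, \<open>L = L / 2\<close>.\<close>
  have "(\<lambda>j. E j + Y (n j) / 2) \<longlonglongrightarrow> 0 + L / 2"
    by (intro tendsto_intros E0 filterlim_compose[OF L n(2)]) auto
  moreover have "(\<lambda>j. E j + Y (n j) / 2) = Y" by (rule ext) (rule rec[symmetric])
  ultimately have "Y \<longlonglongrightarrow> L / 2" by simp
  then have "L = L / 2" using L LIMSEQ_unique by blast
  then have "L = 0" by simp
  moreover have "E j \<le> Y j" for j using rec[of j] Ynn[of "n j"] by simp
  ultimately show thesis using that antiY L rec by blast
qed

text \<open>Finitely many coordinates converge together, and the remaining ones are uniformly small
  by \<open>B\<close>. In this way a null bound acts as compactness in c0.\<close>

lemma c0_dominated_convergence:
  fixes x :: "nat \<Rightarrow> c0"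
  assumes bd: "\<And>k i. \<bar>coord (x k) i\<bar> \<le> B i" and B: "B \<longlonglongrightarrow> 0"
    and conv: "\<And>i. convergent (\<lambda>k. coord (x k) i)"
  shows "convergent x"
proof -
  obtain l where l: "\<And>i. (\<lambda>k. coord (x k) i) \<longlonglongrightarrow> l i"
    using conv unfolding convergent_def by metis
  have lB: "\<bar>l i\<bar> \<le> B i" for i
    using tendsto_rabs[OF l[of i]] bd by (meson LIMSEQ_le_const2)
  have "l \<longlonglongrightarrow> 0"
    by (rule Lim_null_comparison[OF _ B]) (simp add: lB)
  then have cl: "coord (Abs_c0 l) = l" by (simp add: Abs_c0_inverse)
  have "x \<longlonglongrightarrow> Abs_c0 l"
  proof (rule metric_LIMSEQ_I)
    fix e :: real assume e: "0 < e"
    obtain J where J: "\<And>i. i \<ge> J \<Longrightarrow> B i < e / 4"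
      using order_tendstoD(2)[OF B, of "e/4"] e unfolding eventually_sequentially by auto
    have "\<forall>\<^sub>F k in sequentially. dist (coord (x k) i) (l i) < e/2" for i
      using tendstoD[OF l[of i], of "e/2"] e by simp
    then have "\<forall>\<^sub>F k in sequentially. \<forall>i\<in>{..<J}. dist (coord (x k) i) (l i) < e/2"
      by (intro eventually_ball_finite) auto
    then obtain N where N: "\<And>k i. k \<ge> N \<Longrightarrow> i < J \<Longrightarrow> \<bar>coord (x k) i - l i\<bar> < e/2"
      unfolding eventually_sequentially dist_real_def by blast
    have "norm (x k - Abs_c0 l) \<le> e/2" if k: "k \<ge> N" for k
    proof (rule norm_c0_leI)
      fix i
      show "\<bar>coord (x k - Abs_c0 l) i\<bar> \<le> e/2"
      proof (cases "i < J")
        case True then show ?thesis using N[OF k True] by (simp add: minus_c0.rep_eq cl)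
      next
        case False
        then have "\<bar>coord (x k) i\<bar> < e/4" "\<bar>l i\<bar> < e/4"
          using J[of i] bd[of k i] lB[of i] by auto
        then have "\<bar>coord (x k) i - l i\<bar> \<le> e/2" by linarith
        then show ?thesis by (simp add: minus_c0.rep_eq cl)
      qed
    qed
    then show "\<exists>N. \<forall>k\<ge>N. dist (x k) (Abs_c0 l) < e"
      using e by (metis dist_norm field_sum_of_halves less_add_same_cancel2 half_gt_zero le_less_trans)
  qed
  then show ?thesis by (auto simp: convergent_def)
qed

text \<open>Arzela-Ascoli in pointwise form: a diagonal subsequence converges in every coordinate at
  every point of a countable dense subset of \<open>K\<close>, and the common Lipschitz constant
  carries convergence to all of \<open>K\<close>.\<close>

lemma c0_equilipschitz_subsequence:
  fixes v :: "nat \<Rightarrow> 'a::{metric_space, second_countable_topology} \<Rightarrow> c0"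
  assumes lip: "\<And>k s t. s \<in> K \<Longrightarrow> t \<in> K \<Longrightarrow> norm (v k s - v k t) \<le> M * dist s t" and M: "0 \<le> M"
    and bd: "\<And>k t i. t \<in> K \<Longrightarrow> \<bar>coord (v k t) i\<bar> \<le> B i" and B: "B \<longlonglongrightarrow> 0"
  obtains r u where "strict_mono (r :: nat \<Rightarrow> nat)" "\<And>t. t \<in> K \<Longrightarrow> (\<lambda>k. v (r k) t) \<longlonglongrightarrow> u t"
proof -
  obtain D where D: "countable D" "D \<subseteq> K" "K \<subseteq> closure D"
    using separable by blast
  obtain C where C: "\<And>i. norm (B i) \<le> C"
    using B convergentI convergent_imp_Bseq Bseq_def by metis
  have 1: "countable ((UNIV :: nat set) \<times> D)" using D(1) by simp
  have 2: "norm (coord (v k (snd z)) (fst z)) \<le> C" if "z \<in> UNIV \<times> D" for k z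
    using bd[of "snd z" k "fst z"] C[of "fst z"] that D(2) by force
  obtain r :: "nat \<Rightarrow> nat" where r: "strict_mono r"
    and conv: "\<And>z. z \<in> UNIV \<times> D \<Longrightarrow> \<exists>l. (\<lambda>k. coord (v (r k) (snd z)) (fst z)) \<longlonglongrightarrow> l"
    using function_convergent_subsequence[OF 1, of "\<lambda>k z. coord (v k (snd z)) (fst z)" C] 2 by blast
  have convD: "convergent (\<lambda>k. v (r k) q)" if q: "q \<in> D" for q
    using conv[of "(_, q)"] q D(2) bd B
    by (intro c0_dominated_convergence[where B = B]) (auto simp: convergent_def)
  have "convergent (\<lambda>k. v (r k) t)" if t: "t \<in> K" for t
  proof -
    have "Cauchy (\<lambda>k. v (r k) t)"
    proof (rule metric_CauchyI)
      fix e :: real assume e: "0 < e"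
      have "t \<in> closure D" using t D(3) by blast
      \<comment> \<open>\<open>M + 1\<close> instead of \<open>M\<close> keeps the radius positive
        when \<open>M = 0\<close>.\<close>
      then obtain q where q: "q \<in> D" "dist q t < e / (3 * (M + 1))"
        using M e unfolding closure_approachable
        by (metis add_nonneg_pos divide_pos_pos mult_pos_pos zero_less_numeral zero_less_one)
      obtain N where N: "\<And>k m. k \<ge> N \<Longrightarrow> m \<ge> N \<Longrightarrow> dist (v (r k) q) (v (r m) q) < e/3"
        using metric_CauchyD[OF convergent_Cauchy[OF convD[OF q(1)]], of "e/3"] e by auto
      have *: "dist (v (r k) t) (v (r k) q) < e/3" for k
      proof -
        have "dist (v (r k) t) (v (r k) q) \<le> M * dist t q"
          using lip[of t q "r k"] t q D(2) by (auto simp: dist_norm)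
        also have "\<dots> \<le> (M+1) * dist q t" using M by (simp add: dist_commute mult_right_mono)
        also have "\<dots> < e/3" using q(2) M by (simp add: field_simps)
        finally show ?thesis .
      qed
      have "dist (v (r k) t) (v (r m) t) < e" if "k \<ge> N" "m \<ge> N" for k m
        using *[of k] *[of m] N[OF that] dist_triangle[of "v (r k) t" "v (r m) t" "v (r k) q"]
          dist_triangle[of "v (r k) q" "v (r m) t" "v (r m) q"]
        by (simp add: dist_commute)
      then show "\<exists>N. \<forall>k\<ge>N. \<forall>m\<ge>N. dist (v (r k) t) (v (r m) t) < e" by blast
    qed
    then show ?thesis by (simp add: Cauchy_convergent)
  qed
  then obtain u where "\<And>t. t \<in> K \<Longrightarrow> (\<lambda>k. v (r k) t) \<longlonglongrightarrow> u t"
    unfolding convergent_def by metis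
  then show thesis using that r by blast
qed

section \<open>Compact time scales\<close>

text \<open>A supremum argument in place of a finite partition: \<open>left\<close> carries
  \<open>P\<close> up to the supremum of the points where it holds, and \<open>right\<close> rules
  out a supremum below \<open>d\<close>.\<close>

lemma ts_chain_induct:
  fixes K :: "real set"
  assumes K: "closed K" "a \<in> K" "d \<in> K" "K \<subseteq> {a..d}"
    and init: "P a"
    and step: "\<And>s t. s \<in> K \<Longrightarrow> t \<in> K \<Longrightarrow> s < t \<Longrightarrow> R s t \<Longrightarrow> P s \<Longrightarrow> P t"
    and left: "\<And>c. c \<in> K \<Longrightarrow> \<exists>\<eta>>0. \<forall>s\<in>K. c - \<eta> < s \<longrightarrow> s < c \<longrightarrow> R s c"
    and right: "\<And>c. c \<in> K \<Longrightarrow> c < d \<Longrightarrow> \<exists>t\<in>K. c < t \<and> R c t"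
  shows "P d"
proof -
  define C where "C = {c \<in> K. P c}"
  have ne: "C \<noteq> {}" using K(2) init by (auto simp: C_def)
  have bdd: "bdd_above C" using K(4) by (intro bdd_above_mono[of "{a..d}" C]) (auto simp: C_def)
  have "Sup C \<in> closure C" using closure_contains_Sup[OF ne bdd] .
  moreover have "closure C \<subseteq> K" using K(1) by (intro closure_minimal) (auto simp: C_def)
  ultimately have sK: "Sup C \<in> K" by blast
  have Ps: "P (Sup C)"
  proof -
    obtain \<eta> where \<eta>: "\<eta> > 0" "\<And>s. s \<in> K \<Longrightarrow> Sup C - \<eta> < s \<Longrightarrow> s < Sup C \<Longrightarrow> R s (Sup C)"
      using left[OF sK] by blast
    have "Sup C - \<eta> < Sup C" using \<eta>(1) by simp
    then obtain c where c: "c \<in> C" "Sup C - \<eta> < c"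
      using less_cSup_iff[OF ne bdd] by blast
    have "c \<le> Sup C" using cSup_upper[OF c(1) bdd] .
    then show ?thesis
      using c \<eta>(2)[of c] step[of c "Sup C"] sK by (cases "c = Sup C") (auto simp: C_def)
  qed
  have "\<not> Sup C < d"
  proof
    assume "Sup C < d"
    then obtain t where t: "t \<in> K" "Sup C < t" "R (Sup C) t" using right[OF sK] by blast
    then have "t \<in> C" using step[OF sK] Ps by (auto simp: C_def)
    then show False using cSup_upper[OF _ bdd] t(2) by fastforce
  qed
  then show ?thesis using Ps sK K(4) by (metis atLeastAtMost_iff le_less subsetD)
qed

text \<open>The interval is its own time scale: \<open>d\<close> is fixed by the forward jump and
  counts as right-dense even if it is right-scattered in a larger time scale.\<close>

locale compact_ts =
  fixes K :: "real set" and a d :: real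
  assumes closed_K: "closed K" and a_in: "a \<in> K" and d_in: "d \<in> K" and K_sub: "K \<subseteq> {a..d}"
begin

lemma bdd_K: "S \<subseteq> K \<Longrightarrow> bdd_above S" "S \<subseteq> K \<Longrightarrow> bdd_below S"
  using K_sub bdd_above_mono[of "{a..d}" S] bdd_below_mono[of "{a..d}" S] by auto

lemma Sup_K: "Sup K = d"
  using d_in K_sub by (intro cSup_eq_maximum) auto

lemma Inf_K: "Inf K = a"
  using a_in K_sub by (intro cInf_eq_minimum) auto

lemma forward_jump_max: "forward_jump K d = d"
proof -
  have "{s \<in> K. s > d} = {}" using K_sub by auto
  then show ?thesis by (simp add: forward_jump_def ts_Inf_def Sup_K)
qed

lemma forward_jump_eq: "t < d \<Longrightarrow> forward_jump K t = Inf {s \<in> K. s > t}"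
  using d_in by (auto simp: forward_jump_def ts_Inf_def)

lemma forward_jump_ge: "t \<in> K \<Longrightarrow> t \<le> forward_jump K t"
proof (cases "t = d")
  case True then show ?thesis using forward_jump_max by simp
next
  case False
  assume "t \<in> K"
  with False have "t < d" using K_sub by force
  then show ?thesis using d_in by (auto simp: forward_jump_eq intro!: cInf_greatest)
qed

lemma forward_jump_le: "s \<in> K \<Longrightarrow> t < s \<Longrightarrow> forward_jump K t \<le> s"
proof -
  assume s: "s \<in> K" "t < s"
  then have "t < d" using K_sub by auto
  moreover have "bdd_below {s \<in> K. s > t}" by (intro bdd_K) auto
  ultimately show ?thesis using s by (auto simp: forward_jump_eq intro: cInf_lower)
qed

lemma forward_jump_in: assumes "t \<in> K" shows "forward_jump K t \<in> K"
proof (cases "t = d")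
  case True then show ?thesis using forward_jump_max d_in by simp
next
  case False
  then have td: "t < d" using assms K_sub by auto
  have "Inf {s \<in> K. s > t} \<in> closure {s \<in> K. s > t}"
    using td d_in by (intro closure_contains_Inf) (auto intro!: bdd_K)
  moreover have "closure {s \<in> K. s > t} \<subseteq> K" using closed_K by (intro closure_minimal) auto
  ultimately show ?thesis using td forward_jump_eq by auto
qed

lemma right_dense_approach:
  assumes "t \<in> K" "t < d" "right_dense K t" "0 < \<eta>"
  shows "\<exists>s\<in>K. t < s \<and> s < t + \<eta>"
proof -
  have "Inf {s \<in> K. s > t} < t + \<eta>"
    using assms forward_jump_eq[of t] by (simp add: right_dense_def)
  then show ?thesis
    using assms(2) d_in by (subst (asm) cInf_less_iff) (auto intro!: bdd_K)
qed

text \<open>A point removed by \<open>ts_kappa\<close> is a left-scattered maximum, hence at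
  positive distance from the rest of \<open>K\<close>; derivative and continuity conditions become
  trivial there.\<close>

lemma not_kappa:
  assumes "t \<in> K" "t \<notin> ts_kappa K"
  shows "t = d" "\<exists>\<eta>>0. \<forall>s\<in>K. \<bar>s - d\<bar> < \<eta> \<longrightarrow> s = d" "\<not> left_dense K t"
proof -
  have max: "\<forall>s\<in>K. s \<le> t" and ls: "left_scattered K t"
    using assms by (auto simp: ts_kappa_def)
  then show td: "t = d" using assms(1) d_in K_sub by fastforce
  show "\<not> left_dense K t" using ls by (simp add: left_dense_def left_scattered_def)
  have "s \<le> backward_jump K d" if "s \<in> K" "s < d" for s
    using that unfolding backward_jump_def ts_Sup_def
    by (auto intro!: cSup_upper bdd_K)
  then show "\<exists>\<eta>>0. \<forall>s\<in>K. \<bar>s - d\<bar> < \<eta> \<longrightarrow> s = d"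
    using ls td K_sub unfolding left_scattered_def
    by (intro exI[of _ "d - backward_jump K d"]) force
qed

lemma ts_kappa_subset: "ts_kappa K \<subseteq> K"
  by (auto simp: ts_kappa_def)

lemma kappaI: "t \<in> K \<Longrightarrow> t < d \<Longrightarrow> t \<in> ts_kappa K"
  using not_kappa(1) by blast

end

section \<open>Euler polygons confined to a tube\<close>

text \<open>\<open>osc\<close> and \<open>unif\<close> are local forms of (i) and (ii).
  Right-density is taken in \<open>K\<close>, so at \<open>d\<close>, which is always right-dense,
  \<open>osc\<close> also compares \<open>f d\<close> with earlier times.\<close>

locale rd_rhs = compact_ts K a d for K a d +
  fixes D :: "'e::banach set" and f :: "real \<Rightarrow> 'e \<Rightarrow> 'e" and M :: real
  assumes M_nonneg: "0 \<le> M"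
    and osc: "\<And>c \<epsilon>. c \<in> K \<Longrightarrow> 0 < \<epsilon> \<Longrightarrow> \<exists>\<eta>>0. \<forall>s\<in>K. \<forall>t\<in>K. \<forall>x\<in>D.
        \<bar>s - c\<bar> < \<eta> \<longrightarrow> \<bar>t - c\<bar> < \<eta> \<longrightarrow> right_dense K c \<or> s < c \<and> t < c \<or> c \<le> s \<and> c \<le> t \<longrightarrow>
        norm (f s x - f t x) \<le> \<epsilon>"
    and unif: "\<And>\<epsilon>. 0 < \<epsilon> \<Longrightarrow> \<exists>\<delta>>0. \<forall>t\<in>K. \<forall>x\<in>D. \<forall>y\<in>D. norm (x - y) < \<delta> \<longrightarrow> norm (f t x - f t y) \<le> \<epsilon>"
begin

text \<open>Freezing the right-hand side at the left end \<open>s\<close> costs at most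
  \<open>\<epsilon>\<close>, for all states in \<open>D\<close> reachable at speed \<open>M\<close>.
  Excluding \<open>t\<close> lets a step end where \<open>f\<close> jumps in time and makes a step
  across a gap free.\<close>

definition nearly_const :: "real \<Rightarrow> real \<Rightarrow> real \<Rightarrow> bool"
  where "nearly_const \<epsilon> s t \<longleftrightarrow> (\<forall>\<tau>\<in>K. s \<le> \<tau> \<longrightarrow> \<tau> < t \<longrightarrow>
    (\<forall>x\<in>D. \<forall>y\<in>D. norm (y - x) \<le> M * (\<tau> - s) \<longrightarrow> norm (f \<tau> y - f s x) \<le> \<epsilon>))"

text \<open>Two times within \<open>\<eta>\<close> of \<open>c\<close> are less than
  \<open>2 * \<eta>\<close> apart, so \<open>2 * M * \<eta>\<close> bounds the distance that an
  \<open>M\<close>-Lipschitz curve covers between them.\<close>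

lemma rhs_osc:
  assumes c: "c \<in> K" and e: "0 < \<epsilon>"
  obtains \<eta> where "\<eta> > 0" "\<And>s \<tau> x y. s \<in> K \<Longrightarrow> \<tau> \<in> K \<Longrightarrow> x \<in> D \<Longrightarrow> y \<in> D \<Longrightarrow> \<bar>s - c\<bar> < \<eta> \<Longrightarrow>
    \<bar>\<tau> - c\<bar> < \<eta> \<Longrightarrow> right_dense K c \<or> s < c \<and> \<tau> < c \<or> c \<le> s \<and> c \<le> \<tau> \<Longrightarrow>
    norm (y - x) \<le> 2 * M * \<eta> \<Longrightarrow> norm (f \<tau> y - f s x) \<le> \<epsilon>"
proof -
  obtain \<eta> where \<eta>: "\<eta> > 0" "\<And>s t x. s \<in> K \<Longrightarrow> t \<in> K \<Longrightarrow> x \<in> D \<Longrightarrow> \<bar>s - c\<bar> < \<eta> \<Longrightarrow>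
      \<bar>t - c\<bar> < \<eta> \<Longrightarrow> right_dense K c \<or> s < c \<and> t < c \<or> c \<le> s \<and> c \<le> t \<Longrightarrow>
      norm (f s x - f t x) \<le> \<epsilon>/2"
    using osc[OF c, of "\<epsilon>/2"] e by (metis half_gt_zero)
  obtain \<delta> where \<delta>: "\<delta> > 0" "\<And>t x y. t \<in> K \<Longrightarrow> x \<in> D \<Longrightarrow> y \<in> D \<Longrightarrow> norm (x - y) < \<delta> \<Longrightarrow>
      norm (f t x - f t y) \<le> \<epsilon>/2"
    using unif[of "\<epsilon>/2"] e by (metis half_gt_zero)
  \<comment> \<open>The \<open>+ 1\<close> keeps \<open>\<kappa>\<close> positive for
    \<open>M = 0\<close> and makes \<open>2 * M * \<kappa> < \<delta>\<close> strict.\<close>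
  define \<kappa> where "\<kappa> = min \<eta> (\<delta> / (2 * M + 1))"
  have pos: "\<kappa> > 0" using \<eta> \<delta> M_nonneg by (simp add: \<kappa>_def)
  have "2 * M * \<kappa> < (2 * M + 1) * \<kappa>" using pos by simp
  also have "\<dots> \<le> (2 * M + 1) * (\<delta> / (2 * M + 1))"
    using M_nonneg by (intro mult_left_mono) (auto simp: \<kappa>_def)
  also have "\<dots> = \<delta>" using M_nonneg by simp
  finally have lt: "2 * M * \<kappa> < \<delta>" .
  show thesis
  proof (rule that[OF pos])
    fix s \<tau> x y assume h: "s \<in> K" "\<tau> \<in> K" "x \<in> D" "y \<in> D" "\<bar>s - c\<bar> < \<kappa>" "\<bar>\<tau> - c\<bar> < \<kappa>"
      "right_dense K c \<or> s < c \<and> \<tau> < c \<or> c \<le> s \<and> c \<le> \<tau>" "norm (y - x) \<le> 2 * M * \<kappa>"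
    have "\<kappa> \<le> \<eta>" by (simp add: \<kappa>_def)
    then have "norm (f \<tau> y - f s y) \<le> \<epsilon>/2" using h by (intro \<eta>(2)) auto
    moreover have "norm (f s y - f s x) \<le> \<epsilon>/2" using h lt by (intro \<delta>(2)) auto
    ultimately show "norm (f \<tau> y - f s x) \<le> \<epsilon>"
      using norm_triangle_ineq[of "f \<tau> y - f s y" "f s y - f s x"] by simp
  qed
qed

text \<open>A step ending no later than \<open>c\<close> sees only times before \<open>c\<close>; a
  step starting at \<open>c\<close> sees only times from \<open>c\<close> on. Either way an
  admissible case of \<open>osc\<close> applies, even if \<open>c\<close> is
  right-scattered.\<close>

lemma nearly_const_near:
  assumes c: "c \<in> K" and e: "0 < \<epsilon>"
  obtains \<eta> where "\<eta> > 0" "\<And>s t. s \<in> K \<Longrightarrow> s \<le> t \<Longrightarrow> c - \<eta> < s \<Longrightarrow> t \<le> c \<Longrightarrow> nearly_const \<epsilon> s t"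
    "\<And>t. t \<le> c + \<eta> \<Longrightarrow> nearly_const \<epsilon> c t"
proof -
  obtain \<eta> where \<eta>: "\<eta> > 0" "\<And>s \<tau> x y. s \<in> K \<Longrightarrow> \<tau> \<in> K \<Longrightarrow> x \<in> D \<Longrightarrow> y \<in> D \<Longrightarrow> \<bar>s - c\<bar> < \<eta> \<Longrightarrow>
    \<bar>\<tau> - c\<bar> < \<eta> \<Longrightarrow> right_dense K c \<or> s < c \<and> \<tau> < c \<or> c \<le> s \<and> c \<le> \<tau> \<Longrightarrow>
    norm (y - x) \<le> 2 * M * \<eta> \<Longrightarrow> norm (f \<tau> y - f s x) \<le> \<epsilon>"
    using rhs_osc[OF c e] by metis
  have M: "M * r \<le> 2 * M * \<eta>" if "r \<le> \<eta>" for r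
  proof -
    have "M * r \<le> M * (2 * \<eta>)" using that M_nonneg \<eta>(1) by (intro mult_left_mono) auto
    then show ?thesis by (simp add: mult_ac)
  qed
  show thesis
  proof (rule that[OF \<eta>(1)])
    fix s t assume h: "s \<in> K" "s \<le> t" "c - \<eta> < s" "t \<le> c"
    show "nearly_const \<epsilon> s t"
      unfolding nearly_const_def
    proof (intro ballI impI)
      fix \<tau> x y assume g: "\<tau> \<in> K" "s \<le> \<tau>" "\<tau> < t" "x \<in> D" "y \<in> D" "norm (y - x) \<le> M * (\<tau> - s)"
      have "M * (\<tau> - s) \<le> 2 * M * \<eta>" by (rule M) (use g h in linarith)
      then show "norm (f \<tau> y - f s x) \<le> \<epsilon>" using g h by (intro \<eta>(2)) auto
    qed
  next
    fix t assume h: "t \<le> c + \<eta>"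
    show "nearly_const \<epsilon> c t"
      unfolding nearly_const_def
    proof (intro ballI impI)
      fix \<tau> x y assume g: "\<tau> \<in> K" "c \<le> \<tau>" "\<tau> < t" "x \<in> D" "y \<in> D" "norm (y - x) \<le> M * (\<tau> - c)"
      have "M * (\<tau> - c) \<le> 2 * M * \<eta>" by (rule M) (use g h in linarith)
      then show "norm (f \<tau> y - f c x) \<le> \<epsilon>" using g h c \<eta>(1) by (intro \<eta>(2)) auto
    qed
  qed
qed

lemma nearly_const_induct:
  assumes e: "0 < \<epsilon>" and init: "P a"
    and step: "\<And>s t. s \<in> K \<Longrightarrow> t \<in> K \<Longrightarrow> s < t \<Longrightarrow> nearly_const \<epsilon> s t \<Longrightarrow> P s \<Longrightarrow> P t"
  shows "P d"
proof (rule ts_chain_induct[OF closed_K a_in d_in K_sub, where R = "nearly_const \<epsilon>"])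
  fix c assume c: "c \<in> K"
  then obtain \<eta> where \<eta>: "\<eta> > 0" "\<And>s t. s \<in> K \<Longrightarrow> s \<le> t \<Longrightarrow> c - \<eta> < s \<Longrightarrow> t \<le> c \<Longrightarrow> nearly_const \<epsilon> s t"
    "\<And>t. t \<le> c + \<eta> \<Longrightarrow> nearly_const \<epsilon> c t"
    using nearly_const_near[OF c e] by metis
  then show "\<exists>\<eta>>0. \<forall>s\<in>K. c - \<eta> < s \<longrightarrow> s < c \<longrightarrow> nearly_const \<epsilon> s c"
    by (metis less_imp_le order_refl)
  assume cd: "c < d"
  show "\<exists>t\<in>K. c < t \<and> nearly_const \<epsilon> c t"
  proof (cases "right_dense K c")
    case True
    then show ?thesis
      using right_dense_approach[OF c cd True \<eta>(1)] \<eta>(3) by (meson less_imp_le)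
  next
    case False
    then have lt: "c < forward_jump K c"
      using forward_jump_ge[OF c] by (simp add: right_dense_def)
    \<comment> \<open>Across a gap the half-open step contains only \<open>c\<close>, and zero
      elapsed time forces equal states.\<close>
    have "\<tau> = c" if "\<tau> \<in> K" "c \<le> \<tau>" "\<tau> < forward_jump K c" for \<tau>
      using forward_jump_le[of \<tau> c] that by force
    then have "nearly_const \<epsilon> c (forward_jump K c)"
      unfolding nearly_const_def using e by force
    then show ?thesis using lt forward_jump_in[OF c] by blast
  qed
qed (use init step in auto)

end

text \<open>\<open>X_step\<close> covers steps of any length, so the tube is invariant however the
  steps are chosen. \<open>X_sub\<close> omits a left-scattered maximum and \<open>X_bound\<close>
  omits \<open>d\<close>, because no step starts there.\<close>

locale euler_tube = rd_rhs K a d D f M for K a d and D :: "'e::banach set" and f M +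
  fixes X :: "real \<Rightarrow> 'e set" and \<phi> :: 'e
  assumes X_sub: "\<And>t. t \<in> ts_kappa K \<Longrightarrow> X t \<subseteq> D"
    and X_init: "\<phi> \<in> X a"
    and X_bound: "\<And>t x. t \<in> K \<Longrightarrow> t < d \<Longrightarrow> x \<in> X t \<Longrightarrow> norm (f t x) \<le> M"
    and X_step: "\<And>s t x. s \<in> K \<Longrightarrow> t \<in> K \<Longrightarrow> s < t \<Longrightarrow> x \<in> X s \<Longrightarrow> x + (t - s) *\<^sub>R f s x \<in> X t"
begin

text \<open>
  The last clause is a mean value inequality: it is what survives in the limit and replaces the
  integral equation.
\<close>

definition approx_sol :: "real \<Rightarrow> real \<Rightarrow> (real \<Rightarrow> 'e) \<Rightarrow> bool"
  where "approx_sol \<epsilon> c u \<longleftrightarrow> u a = \<phi> \<and> (\<forall>t\<in>K. t \<le> c \<longrightarrow> u t \<in> X t) \<and>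
    (\<forall>s\<in>K. \<forall>t\<in>K. s \<le> t \<longrightarrow> t \<le> c \<longrightarrow> norm (u t - u s) \<le> M * (t - s)) \<and>
    (\<forall>s\<in>K. \<forall>t\<in>K. s \<le> t \<longrightarrow> t \<le> c \<longrightarrow> (\<forall>z R.
      (\<forall>\<tau>\<in>K. s \<le> \<tau> \<longrightarrow> \<tau> < t \<longrightarrow> norm (f \<tau> (u \<tau>) - z) \<le> R) \<longrightarrow>
      norm (u t - u s - (t - s) *\<^sub>R z) \<le> (t - s) * (R + \<epsilon>)))"

lemma approx_sol_step:
  assumes u: "approx_sol \<epsilon> c u" and c: "c \<in> K" "c' \<in> K" "c < c'"
    and nc: "nearly_const \<epsilon> c c'"
  shows "approx_sol \<epsilon> c' (\<lambda>t. if t \<le> c then u t else u c + (t - c) *\<^sub>R f c (u c))"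
proof -
  define v where "v = (\<lambda>t. if t \<le> c then u t else u c + (t - c) *\<^sub>R f c (u c))"
  let ?F = "f c (u c)"
  have cd: "c < d" using c K_sub by auto
  have ua: "u a = \<phi>" and uX: "\<And>t. t \<in> K \<Longrightarrow> t \<le> c \<Longrightarrow> u t \<in> X t"
    and uL: "\<And>s t. s \<in> K \<Longrightarrow> t \<in> K \<Longrightarrow> s \<le> t \<Longrightarrow> t \<le> c \<Longrightarrow> norm (u t - u s) \<le> M * (t - s)"
    and uMV: "\<And>s t z R. s \<in> K \<Longrightarrow> t \<in> K \<Longrightarrow> s \<le> t \<Longrightarrow> t \<le> c \<Longrightarrow>
      (\<And>\<tau>. \<tau> \<in> K \<Longrightarrow> s \<le> \<tau> \<Longrightarrow> \<tau> < t \<Longrightarrow> norm (f \<tau> (u \<tau>) - z) \<le> R) \<Longrightarrow>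
      norm (u t - u s - (t - s) *\<^sub>R z) \<le> (t - s) * (R + \<epsilon>)"
    using u unfolding approx_sol_def by blast+
  have v_le: "v t = u t" if "t \<le> c" for t using that by (simp add: v_def)
  have v_ge: "v t = u c + (t - c) *\<^sub>R ?F" if "c \<le> t" for t using that by (simp add: v_def)
  have FM: "norm ?F \<le> M" using X_bound[OF c(1) cd] uX[OF c(1)] by simp
  have vX: "v t \<in> X t" if t: "t \<in> K" "t \<le> c'" for t
    using uX[of t] X_step[OF c(1) t(1) _ uX[OF c(1)]] t by (auto simp: v_def)
  have vD: "v t \<in> D" if t: "t \<in> K" "t < c'" for t
    using vX[of t] X_sub[OF kappaI[of t]] t c K_sub by fastforce
  have lin: "norm (v t - v s) \<le> M * (t - s)" if "c \<le> s" "s \<le> t" for s t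
  proof -
    have "v t - v s = (t - s) *\<^sub>R ?F" unfolding v_ge[OF that(1)] v_ge[OF order_trans[OF that]] by (simp add: algebra_simps)
    then show ?thesis using mult_right_mono[OF FM, of "t - s"] that by (simp add: mult.commute)
  qed
  have L: "norm (v t - v s) \<le> M * (t - s)" if st: "s \<in> K" "t \<in> K" "s \<le> t" "t \<le> c'" for s t
  proof -
    consider "t \<le> c" | "c \<le> s" | "s \<le> c" "c \<le> t" by linarith
    then show ?thesis
    proof cases
      case 1 then show ?thesis using uL[of s t] st v_le by simp
    next
      case 2 then show ?thesis using lin st by blast
    next
      case 3
      have "norm (v t - v s) \<le> norm (v t - v c) + norm (v c - v s)"
        using norm_triangle_ineq[of "v t - v c" "v c - v s"] by simp
      also have "\<dots> \<le> M * (t - c) + M * (c - s)"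
        using lin[of c t] uL[of s c] 3 st c v_le by (intro add_mono) auto
      finally show ?thesis by (simp add: algebra_simps)
    qed
  qed
  have linMV: "norm (v t - v s - (t - s) *\<^sub>R z) \<le> (t - s) * (R + \<epsilon>)"
    if st: "s \<in> K" "c \<le> s" "s \<le> t" "t \<le> c'"
      and R: "\<And>\<tau>. \<tau> \<in> K \<Longrightarrow> s \<le> \<tau> \<Longrightarrow> \<tau> < t \<Longrightarrow> norm (f \<tau> (v \<tau>) - z) \<le> R" for s t z R
  proof (cases "s = t")
    case True then show ?thesis by simp
  next
    case False
    then have s': "s < c'" "s < t" using st by auto
    have "norm (f s (v s) - ?F) \<le> \<epsilon>"
      using nc st s' vD[of s] vD[of c] L[of c s] c v_le[of c] unfolding nearly_const_def by auto
    moreover have "norm (f s (v s) - z) \<le> R" using R st s' by blast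
    ultimately have "norm (?F - z) \<le> R + \<epsilon>"
      using norm_triangle_ineq4[of "f s (v s) - z" "f s (v s) - ?F"] by simp
    moreover have "v t - v s - (t - s) *\<^sub>R z = (t - s) *\<^sub>R (?F - z)"
      unfolding v_ge[OF st(2)] v_ge[OF order_trans[OF st(2,3)]] by (simp add: algebra_simps)
    ultimately show ?thesis using st by (simp add: mult_left_mono)
  qed
  have MV: "norm (v t - v s - (t - s) *\<^sub>R z) \<le> (t - s) * (R + \<epsilon>)"
    if st: "s \<in> K" "t \<in> K" "s \<le> t" "t \<le> c'"
      and R: "\<And>\<tau>. \<tau> \<in> K \<Longrightarrow> s \<le> \<tau> \<Longrightarrow> \<tau> < t \<Longrightarrow> norm (f \<tau> (v \<tau>) - z) \<le> R" for s t z R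
  proof -
    have old: "norm (v r - v s - (r - s) *\<^sub>R z) \<le> (r - s) * (R + \<epsilon>)"
      if r: "r \<in> K" "s \<le> r" "r \<le> c" "r \<le> t" for r
    proof -
      have "norm (f \<tau> (u \<tau>) - z) \<le> R" if "\<tau> \<in> K" "s \<le> \<tau>" "\<tau> < r" for \<tau>
        using R[of \<tau>] v_le[of \<tau>] r that by simp
      from uMV[OF st(1) r(1) r(2) r(3) this] show ?thesis using v_le[of r] v_le[of s] r by simp
    qed
    consider "t \<le> c" | "c \<le> s" | "s \<le> c" "c \<le> t" by linarith
    then show ?thesis
    proof cases
      case 1 then show ?thesis using old[of t] st by blast
    next
      case 2 then show ?thesis using linMV[of s t z R] st R by blast
    next
      case 3
      \<comment> \<open>The right-hand side is additive in the interval, so the two pieces are glued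
        at \<open>c\<close> and errors do not accumulate with the number of steps.\<close>
      have "norm (v t - v s - (t - s) *\<^sub>R z)
          \<le> norm (v t - v c - (t - c) *\<^sub>R z) + norm (v c - v s - (c - s) *\<^sub>R z)"
        using norm_triangle_ineq[of "v t - v c - (t - c) *\<^sub>R z" "v c - v s - (c - s) *\<^sub>R z"]
        by (simp add: algebra_simps)
      also have "\<dots> \<le> (t - c) * (R + \<epsilon>) + (c - s) * (R + \<epsilon>)"
        using old[of c] linMV[of c t z R] 3 st c R by (intro add_mono) auto
      finally show ?thesis by (simp add: algebra_simps)
    qed
  qed
  have va: "v a = \<phi>" using ua c K_sub v_le by auto
  show ?thesis
    unfolding approx_sol_def v_def[symmetric] using va vX L MV by blast
qed

lemma approx_sol_exists:
  assumes "0 < \<epsilon>" shows "\<exists>u. approx_sol \<epsilon> d u"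
proof (rule nearly_const_induct[OF assms, where P = "\<lambda>c. \<exists>u. approx_sol \<epsilon> c u"])
  have "t = a" if "t \<in> K" "t \<le> a" for t using that K_sub by force
  then have *: "s = a \<and> t = a" if "s \<in> K" "t \<in> K" "s \<le> t" "t \<le> a" for s t
    using that by (meson order_trans)
  have "approx_sol \<epsilon> a (\<lambda>_. \<phi>)"
    unfolding approx_sol_def
    by (intro conjI ballI impI allI) (use X_init * in \<open>force dest: *\<close>)+
  then show "\<exists>u. approx_sol \<epsilon> a u" by blast
next
  fix s t assume "s \<in> K" "t \<in> K" "s < t" "nearly_const \<epsilon> s t" "\<exists>u. approx_sol \<epsilon> s u"
  then show "\<exists>u. approx_sol \<epsilon> t u" using approx_sol_step by blast
qed

lemma approx_sol_in_tube: "approx_sol \<epsilon> d u \<Longrightarrow> t \<in> K \<Longrightarrow> u t \<in> X t"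
  using K_sub unfolding approx_sol_def by auto

lemma approx_sol_lipschitz:
  assumes u: "approx_sol \<epsilon> d u" and "s \<in> K" "t \<in> K"
  shows "norm (u t - u s) \<le> M * \<bar>t - s\<bar>"
proof -
  have *: "norm (u t - u s) \<le> M * (t - s)" if "s \<in> K" "t \<in> K" "s \<le> t" for s t
    using u that K_sub unfolding approx_sol_def by force
  show ?thesis
    using *[of s t] *[of t s] assms by (cases "s \<le> t") (auto simp: norm_minus_commute)
qed

end

section \<open>Limits of Euler polygons\<close>

locale euler_limit = euler_tube K a d D f M X \<phi> for K a d and D :: "'e::banach set" and f M X \<phi> +
  fixes \<epsilon> :: "nat \<Rightarrow> real" and v :: "nat \<Rightarrow> real \<Rightarrow> 'e" and u :: "real \<Rightarrow> 'e"
  assumes closed_D: "closed D"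
    and eps: "\<epsilon> \<longlonglongrightarrow> 0"
    and approx: "\<And>k. approx_sol (\<epsilon> k) d (v k)"
    and conv: "\<And>t. t \<in> K \<Longrightarrow> (\<lambda>k. v k t) \<longlonglongrightarrow> u t"
begin

lemma approx_in_D: "t \<in> ts_kappa K \<Longrightarrow> v k t \<in> D"
  using approx_sol_in_tube[OF approx] X_sub ts_kappa_subset by blast

lemma limit_in_D: "t \<in> ts_kappa K \<Longrightarrow> u t \<in> D"
  using closed_sequentially[OF closed_D, of "\<lambda>k. v k t" "u t"] approx_in_D conv[of t]
  by (auto simp: ts_kappa_def)

lemma approx_lipschitz:
  assumes "s \<in> K" "t \<in> K" shows "norm (v k t - v k s) \<le> M * \<bar>t - s\<bar>"
  by (rule approx_sol_lipschitz[OF approx assms])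

lemma limit_lipschitz:
  assumes "s \<in> K" "t \<in> K" shows "norm (u t - u s) \<le> M * \<bar>t - s\<bar>"
  by (rule Lim_bounded[where M = 0, of "\<lambda>k. norm (v k t - v k s)"])
    (use approx_lipschitz assms in \<open>auto intro!: tendsto_intros conv\<close>)

lemma limit_mean_value:
  assumes st: "s \<in> K" "t \<in> K" "s \<le> t"
    and R: "\<forall>\<^sub>F k in sequentially. \<forall>\<tau>\<in>K. s \<le> \<tau> \<longrightarrow> \<tau> < t \<longrightarrow> norm (f \<tau> (v k \<tau>) - z) \<le> R"
  shows "norm (u t - u s - (t - s) *\<^sub>R z) \<le> (t - s) * R"
proof -
  have "(\<lambda>k. norm (v k t - v k s - (t - s) *\<^sub>R z)) \<longlonglongrightarrow> norm (u t - u s - (t - s) *\<^sub>R z)"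
    using st by (intro tendsto_intros conv)
  moreover have "(\<lambda>k. (t - s) * (R + \<epsilon> k)) \<longlonglongrightarrow> (t - s) * (R + 0)"
    by (intro tendsto_intros eps)
  moreover have "\<forall>\<^sub>F k in sequentially. norm (v k t - v k s - (t - s) *\<^sub>R z) \<le> (t - s) * (R + \<epsilon> k)"
    using R
  proof eventually_elim
    case (elim k)
    have "t \<le> d" using st K_sub by auto
    then show ?case using elim approx[of k] st unfolding approx_sol_def by blast
  qed
  ultimately show ?thesis using tendsto_le[OF sequentially_bot] by fastforce
qed

text \<open>Pointwise convergence at \<open>t0\<close> suffices: the common Lipschitz bound and
  \<open>rhs_osc\<close> bring \<open>f \<tau> (v k \<tau>)\<close> close to
  \<open>f t0 (v k t0)\<close> uniformly in \<open>\<tau>\<close> and \<open>k\<close>, and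
  \<open>unif\<close> then replaces \<open>v k t0\<close> by its limit.\<close>

lemma limit_mean_value_near:
  assumes t: "t0 \<in> ts_kappa K" "right_dense K t0" and e: "0 < e"
  obtains \<delta> where "\<delta> > 0" "\<And>s t. s \<in> K \<Longrightarrow> t \<in> K \<Longrightarrow> s \<le> t \<Longrightarrow> \<bar>s - t0\<bar> < \<delta> \<Longrightarrow> \<bar>t - t0\<bar> < \<delta> \<Longrightarrow>
    norm (u t - u s - (t - s) *\<^sub>R f t0 (u t0)) \<le> (t - s) * e"
proof -
  have tK: "t0 \<in> K" using t by (simp add: ts_kappa_def)
  obtain \<eta>' where \<eta>': "\<eta>' > 0" "\<And>s \<tau> x y. s \<in> K \<Longrightarrow> \<tau> \<in> K \<Longrightarrow> x \<in> D \<Longrightarrow> y \<in> D \<Longrightarrow> \<bar>s - t0\<bar> < \<eta>' \<Longrightarrow>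
    \<bar>\<tau> - t0\<bar> < \<eta>' \<Longrightarrow> right_dense K t0 \<or> s < t0 \<and> \<tau> < t0 \<or> t0 \<le> s \<and> t0 \<le> \<tau> \<Longrightarrow>
    norm (y - x) \<le> 2 * M * \<eta>' \<Longrightarrow> norm (f \<tau> y - f s x) \<le> e/2"
    using rhs_osc[OF tK, of "e/2"] e by (metis half_gt_zero)
  obtain \<delta>' where \<delta>': "\<delta>' > 0" "\<And>t x y. t \<in> K \<Longrightarrow> x \<in> D \<Longrightarrow> y \<in> D \<Longrightarrow> norm (x - y) < \<delta>' \<Longrightarrow>
      norm (f t x - f t y) \<le> e/2"
    using unif[of "e/2"] e by (metis half_gt_zero)
  have ev: "\<forall>\<^sub>F k in sequentially. dist (v k t0) (u t0) < \<delta>'"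
    using tendstoD[OF conv[OF tK] \<delta>'(1)] .
  show thesis
  proof (rule that[OF \<eta>'(1)])
    fix s t assume h: "s \<in> K" "t \<in> K" "s \<le> t" "\<bar>s - t0\<bar> < \<eta>'" "\<bar>t - t0\<bar> < \<eta>'"
    show "norm (u t - u s - (t - s) *\<^sub>R f t0 (u t0)) \<le> (t - s) * e"
    proof (rule limit_mean_value[OF h(1-3)])
      show "\<forall>\<^sub>F k in sequentially. \<forall>\<tau>\<in>K. s \<le> \<tau> \<longrightarrow> \<tau> < t \<longrightarrow> norm (f \<tau> (v k \<tau>) - f t0 (u t0)) \<le> e"
        using ev
      proof eventually_elim
        case (elim k)
        show ?case
        proof (intro ballI impI)
          fix \<tau> assume g: "\<tau> \<in> K" "s \<le> \<tau>" "\<tau> < t"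
          then have "\<tau> \<in> ts_kappa K" using h(2) K_sub by (intro kappaI) auto
          then have vD: "v k \<tau> \<in> D" "v k t0 \<in> D" "u t0 \<in> D"
            using approx_in_D limit_in_D t(1) by auto
          have near: "\<bar>\<tau> - t0\<bar> < \<eta>'" using g h by linarith
          have "norm (v k \<tau> - v k t0) \<le> M * \<bar>\<tau> - t0\<bar>" by (rule approx_lipschitz[OF tK g(1)])
          also have "\<dots> \<le> M * (2 * \<eta>')" using near M_nonneg by (intro mult_left_mono) auto
          finally have "norm (f \<tau> (v k \<tau>) - f t0 (v k t0)) \<le> e/2"
            using \<eta>'(1) g near vD tK t(2) by (intro \<eta>'(2)) auto
          moreover have "norm (f t0 (v k t0) - f t0 (u t0)) \<le> e/2"
            using elim vD tK by (intro \<delta>'(2)) (auto simp: dist_norm)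
          ultimately show "norm (f \<tau> (v k \<tau>) - f t0 (u t0)) \<le> e"
            using norm_triangle_ineq[of "f \<tau> (v k \<tau>) - f t0 (v k t0)" "f t0 (v k t0) - f t0 (u t0)"]
            by simp
        qed
      qed
    qed
  qed
qed

text \<open>At a right-scattered \<open>t\<close> the only time from \<open>t\<close> up to its
  forward jump is \<open>t\<close>, so the mean value inequality holds for every positive bound and
  turns into an equation.\<close>

lemma limit_jump:
  assumes t: "t \<in> K" "t < d"
  shows "u (forward_jump K t) - u t = (forward_jump K t - t) *\<^sub>R f t (u t)"
proof (cases "right_dense K t")
  case True then show ?thesis by (simp add: right_dense_def)
next
  case False
  let ?s = "forward_jump K t"
  have lt: "t < ?s" using False forward_jump_ge[OF t(1)] by (simp add: right_dense_def)
  have only: "\<tau> = t" if "\<tau> \<in> K" "t \<le> \<tau>" "\<tau> < ?s" for \<tau>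
    using forward_jump_le[of \<tau> t] that by force
  have tk: "t \<in> ts_kappa K" using kappaI t by blast
  have "norm (u ?s - u t - (?s - t) *\<^sub>R f t (u t)) \<le> (?s - t) * e" if e: "0 < e" for e
  proof (rule limit_mean_value[OF t(1) forward_jump_in[OF t(1)] less_imp_le[OF lt]])
    obtain \<delta> where \<delta>: "\<delta> > 0" "\<And>t x y. t \<in> K \<Longrightarrow> x \<in> D \<Longrightarrow> y \<in> D \<Longrightarrow> norm (x - y) < \<delta> \<Longrightarrow>
        norm (f t x - f t y) \<le> e"
      using unif[OF e] by blast
    have "\<forall>\<^sub>F k in sequentially. dist (v k t) (u t) < \<delta>"
      using tendstoD[OF conv[OF t(1)] \<delta>(1)] .
    then show "\<forall>\<^sub>F k in sequentially. \<forall>\<tau>\<in>K. t \<le> \<tau> \<longrightarrow> \<tau> < ?s \<longrightarrow> norm (f \<tau> (v k \<tau>) - f t (u t)) \<le> e"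
    proof eventually_elim
      case (elim k)
      then have "norm (f t (v k t) - f t (u t)) \<le> e"
        using approx_in_D[OF tk] limit_in_D[OF tk] t by (intro \<delta>(2)) (auto simp: dist_norm)
      then show ?case using only by blast
    qed
  qed
  note bound = this
  have "norm (u ?s - u t - (?s - t) *\<^sub>R f t (u t)) \<le> 0"
  proof (rule field_le_epsilon)
    fix e :: real assume "0 < e"
    then show "norm (u ?s - u t - (?s - t) *\<^sub>R f t (u t)) \<le> 0 + e"
      using bound[of "e / (?s - t)"] lt by simp
  qed
  then show ?thesis by simp
qed

section \<open>Delta-derivative and rd-continuity of the limit\<close>

lemma limit_delta_derivative_right_dense:
  assumes t: "t \<in> ts_kappa K" and rd: "right_dense K t"
  shows "has_delta_derivative K u (f t (u t)) t"
  unfolding has_delta_derivative_def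
proof (intro allI impI)
  fix e :: real assume e: "0 < e"
  have tK: "t \<in> K" using t by (simp add: ts_kappa_def)
  obtain \<delta> where \<delta>: "\<delta> > 0" "\<And>r s. r \<in> K \<Longrightarrow> s \<in> K \<Longrightarrow> r \<le> s \<Longrightarrow> \<bar>r - t\<bar> < \<delta> \<Longrightarrow> \<bar>s - t\<bar> < \<delta> \<Longrightarrow>
    norm (u s - u r - (s - r) *\<^sub>R f t (u t)) \<le> (s - r) * e"
    using limit_mean_value_near[OF t rd e] by metis
  have "norm (u t - u s - (t - s) *\<^sub>R f t (u t)) \<le> e * \<bar>t - s\<bar>" if s: "s \<in> ts_nbhd K \<delta> t" for s
  proof (cases "s \<le> t")
    case True
    then show ?thesis using \<delta>(2)[of s t] s tK \<delta>(1) by (auto simp: ts_nbhd_def mult.commute)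
  next
    case False
    have "u t - u s - (t - s) *\<^sub>R f t (u t) = - (u s - u t - (s - t) *\<^sub>R f t (u t))"
      by (simp add: algebra_simps)
    then have "norm (u t - u s - (t - s) *\<^sub>R f t (u t)) = norm (u s - u t - (s - t) *\<^sub>R f t (u t))"
      by (metis norm_minus_cancel)
    then show ?thesis using False \<delta>(2)[of t s] s tK \<delta>(1) by (auto simp: ts_nbhd_def mult.commute)
  qed
  then show "\<exists>\<delta>>0. \<forall>s\<in>ts_nbhd K \<delta> t.
      norm (u (forward_jump K t) - u s - (forward_jump K t - s) *\<^sub>R f t (u t)) \<le> e * \<bar>forward_jump K t - s\<bar>"
    using \<delta>(1) rd by (auto simp: right_dense_def)
qed

lemma limit_delta_derivative_right_scattered:
  assumes t: "t \<in> K" "t < d" and rs: "t < forward_jump K t"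
  shows "has_delta_derivative K u (f t (u t)) t"
  unfolding has_delta_derivative_def
proof (intro allI impI)
  fix e :: real assume e: "0 < e"
  let ?s = "forward_jump K t"
  let ?z = "f t (u t)"
  let ?C = "M + norm ?z + 1"
  have C: "?C > 0" using M_nonneg norm_ge_zero[of ?z] by linarith
  \<comment> \<open>The first bound keeps \<open>s\<close> at or before \<open>t\<close>; the second
    makes the Lipschitz error \<open>?C * (t - s)\<close> at most \<open>e\<close> times the gap
    after \<open>t\<close>.\<close>
  define \<delta> where "\<delta> = min (?s - t) (e * (?s - t) / ?C)"
  have pos: "\<delta> > 0" using rs e C by (simp add: \<delta>_def)
  have "norm (u ?s - u s - (?s - s) *\<^sub>R ?z) \<le> e * \<bar>?s - s\<bar>" if s: "s \<in> ts_nbhd K \<delta> t" for s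
  proof -
    have sK: "s \<in> K" and near: "\<bar>s - t\<bar> < \<delta>" using s by (auto simp: ts_nbhd_def)
    have le: "s \<le> t"
    proof (rule ccontr)
      assume "\<not> s \<le> t"
      then show False using forward_jump_le[OF sK, of t] near by (auto simp: \<delta>_def)
    qed
    have "u ?s - u s - (?s - s) *\<^sub>R ?z = (u ?s - u t - (?s - t) *\<^sub>R ?z) + (u t - u s - (t - s) *\<^sub>R ?z)"
      by (simp add: algebra_simps)
    also have "\<dots> = u t - u s - (t - s) *\<^sub>R ?z" using limit_jump[OF t] by simp
    finally have "norm (u ?s - u s - (?s - s) *\<^sub>R ?z) \<le> norm (u t - u s) + norm ((t - s) *\<^sub>R ?z)"
      using norm_triangle_ineq4 by metis
    also have "\<dots> \<le> M * (t - s) + (t - s) * norm ?z"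
      using limit_lipschitz[OF sK t(1)] le by simp
    also have "\<dots> \<le> ?C * (t - s)" using le by (simp add: algebra_simps)
    also have "\<dots> \<le> ?C * (e * (?s - t) / ?C)"
      using near C by (intro mult_left_mono) (auto simp: \<delta>_def)
    also have "\<dots> = e * (?s - t)" using C by simp
    also have "\<dots> \<le> e * \<bar>?s - s\<bar>" using le rs e by (intro mult_left_mono) auto
    finally show ?thesis .
  qed
  then show "\<exists>\<delta>>0. \<forall>s\<in>ts_nbhd K \<delta> t. norm (u ?s - u s - (?s - s) *\<^sub>R ?z) \<le> e * \<bar>?s - s\<bar>"
    using pos by blast
qed

lemma limit_delta_derivative:
  assumes t: "t \<in> K" shows "has_delta_derivative K u (f t (u t)) t"
proof (cases "t \<in> ts_kappa K")
  case True
  show ?thesis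
  proof (cases "right_dense K t")
    case False
    then have "t < forward_jump K t" "t \<noteq> d"
      using forward_jump_ge[OF t] forward_jump_max by (auto simp: right_dense_def)
    moreover then have "t < d" using t K_sub by force
    ultimately show ?thesis using limit_delta_derivative_right_scattered t by blast
  qed (use limit_delta_derivative_right_dense True in blast)
next
  case False
  \<comment> \<open>At an isolated maximum every vector is a Delta-derivative, so
    \<open>f d (u d)\<close> serves even when \<open>u d\<close> is outside
    \<open>D\<close>.\<close>
  obtain \<eta> where "\<eta> > 0" "\<forall>s\<in>K. \<bar>s - d\<bar> < \<eta> \<longrightarrow> s = d" using not_kappa(2)[OF t False] by blast
  then have "\<forall>s\<in>ts_nbhd K \<eta> d. s = d" by (auto simp: ts_nbhd_def)
  then show ?thesis
    using \<open>\<eta> > 0\<close> not_kappa(1)[OF t False] forward_jump_max unfolding has_delta_derivative_def by force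
qed

lemma limit_rd_continuous: "rd_continuous K (\<lambda>t. f t (u t))"
  unfolding rd_continuous_def
proof (intro ballI conjI impI)
  fix t assume t: "t \<in> K" and rd: "right_dense K t"
  show "continuous (at t within K) (\<lambda>t. f t (u t))"
    unfolding continuous_within_eps_delta
  proof (intro allI impI)
    fix e :: real assume e: "0 < e"
    show "\<exists>\<delta>>0. \<forall>s\<in>K. dist s t < \<delta> \<longrightarrow> dist (f s (u s)) (f t (u t)) < e"
    proof (cases "t \<in> ts_kappa K")
      case False
      then show ?thesis
        using not_kappa[OF t False] e by (metis dist_real_def dist_self)
    next
      case True
      \<comment> \<open>Within \<open>\<eta>1\<close> all times belong to \<open>ts_kappa K\<close>,
        where \<open>u\<close> is known to take values in \<open>D\<close>.\<close>
      obtain \<eta>1 where \<eta>1: "\<eta>1 > 0" "\<forall>s\<in>K. dist s t < \<eta>1 \<longrightarrow> s \<in> ts_kappa K"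
      proof (cases "t = d")
        case t: True
        have "s \<in> ts_kappa K" if "s \<in> K" for s
          using that t True kappaI[of s] K_sub by (cases "s = d") force+
        then show thesis using that[of 1] by auto
      next
        case False
        then have "t < d" using t K_sub by force
        then show thesis using that[of "d - t"] kappaI by (auto simp: dist_real_def)
      qed
      obtain \<eta> where \<eta>: "\<eta> > 0" "\<And>s \<tau> x y. s \<in> K \<Longrightarrow> \<tau> \<in> K \<Longrightarrow> x \<in> D \<Longrightarrow> y \<in> D \<Longrightarrow> \<bar>s - t\<bar> < \<eta> \<Longrightarrow>
        \<bar>\<tau> - t\<bar> < \<eta> \<Longrightarrow> right_dense K t \<or> s < t \<and> \<tau> < t \<or> t \<le> s \<and> t \<le> \<tau> \<Longrightarrow>
        norm (y - x) \<le> 2 * M * \<eta> \<Longrightarrow> norm (f \<tau> y - f s x) \<le> e/2"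
        using rhs_osc[OF t, of "e/2"] e by (metis half_gt_zero)
      have "dist (f s (u s)) (f t (u t)) < e" if s: "s \<in> K" "dist s t < min \<eta> \<eta>1" for s
      proof -
        have "norm (u s - u t) \<le> M * \<bar>s - t\<bar>" by (rule limit_lipschitz[OF t s(1)])
        also have "\<dots> \<le> M * (2 * \<eta>)"
          using s(2) M_nonneg by (intro mult_left_mono) (auto simp: dist_real_def)
        finally have "norm (f s (u s) - f t (u t)) \<le> e/2"
          using s \<eta>(1) t rd limit_in_D \<eta>1 by (intro \<eta>(2)) (auto simp: dist_real_def)
        then show ?thesis using e by (simp add: dist_norm)
      qed
      then show ?thesis using \<eta>(1) \<eta>1(1) by (metis min_less_iff_conj)
    qed
  qed
next
  fix t assume t: "t \<in> K" and ld: "left_dense K t"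
  let ?F = "at t within (K \<inter> {..<t})"
  let ?g = "\<lambda>s. f s (u s)"
  show "\<exists>l. (?g \<longlongrightarrow> l) ?F"
  proof (cases "?F = bot")
    case True then show ?thesis by simp
  next
    case False
    \<comment> \<open>The left limit may differ from \<open>f t (u t)\<close>, so there is no
      candidate to test; small oscillation to the left of \<open>t\<close> and completeness provide
      it.\<close>
    have "cauchy_filter (filtermap ?g ?F)"
      unfolding cauchy_filter_metric_filtermap
    proof (intro allI impI)
      fix e :: real assume e: "0 < e"
      obtain \<eta> where \<eta>: "\<eta> > 0" "\<And>s \<tau> x y. s \<in> K \<Longrightarrow> \<tau> \<in> K \<Longrightarrow> x \<in> D \<Longrightarrow> y \<in> D \<Longrightarrow> \<bar>s - t\<bar> < \<eta> \<Longrightarrow>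
        \<bar>\<tau> - t\<bar> < \<eta> \<Longrightarrow> right_dense K t \<or> s < t \<and> \<tau> < t \<or> t \<le> s \<and> t \<le> \<tau> \<Longrightarrow>
        norm (y - x) \<le> 2 * M * \<eta> \<Longrightarrow> norm (f \<tau> y - f s x) \<le> e/2"
        using rhs_osc[OF t, of "e/2"] e by (metis half_gt_zero)
      let ?P = "\<lambda>s. s \<in> K \<and> s < t \<and> dist s t < \<eta>"
      have "eventually ?P ?F"
        unfolding eventually_at using \<eta>(1) by auto
      moreover have "dist (?g x) (?g y) < e" if xy: "?P x" "?P y" for x y
      proof -
        have k: "x \<in> ts_kappa K" "y \<in> ts_kappa K" using xy t K_sub by (auto intro!: kappaI)
        have "norm (u x - u y) \<le> M * \<bar>x - y\<bar>" using limit_lipschitz xy by blast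
        also have "\<dots> \<le> M * (2 * \<eta>)"
          using xy M_nonneg by (intro mult_left_mono) (auto simp: dist_real_def)
        finally have "norm (?g x - ?g y) \<le> e/2"
          using xy k limit_in_D by (intro \<eta>(2)) (auto simp: dist_real_def)
        then show ?thesis using e by (simp add: dist_norm)
      qed
      ultimately show "\<exists>P. eventually P ?F \<and> (\<forall>x y. P x \<and> P y \<longrightarrow> dist (?g x) (?g y) < e)"
        by blast
    qed
    then have "\<exists>l. filtermap ?g ?F \<le> nhds l"
      using False by (intro cauchy_filter_complete_converges[OF _ complete_UNIV]) (auto simp: filtermap_bot_iff)
    then show ?thesis by (simp add: filterlim_def)
  qed
qed

theorem limit_solution: "ivp_solution K a D \<phi> f u"
proof -
  have "continuous_on K u"
    using limit_lipschitz M_nonneg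
    by (intro lipschitz_on_continuous_on[of M] lipschitz_onI) (auto simp: dist_norm)
  then have "u \<in> C1_rd K"
    unfolding C1_rd_def using limit_delta_derivative limit_rd_continuous
    by (intro CollectI conjI exI[of _ "\<lambda>t. f t (u t)"]) auto
  moreover have "u a = \<phi>"
  proof (rule LIMSEQ_unique[OF conv[OF a_in]])
    show "(\<lambda>k. v k a) \<longlonglongrightarrow> \<phi>" using approx by (simp add: approx_sol_def)
  qed
  ultimately show ?thesis
    unfolding ivp_solution_def
    using limit_delta_derivative limit_in_D by (blast dest: subsetD[OF ts_kappa_subset])
qed

end

section \<open>Tail estimates in the space of null sequences\<close>

lemma uniform_tail_majorant:
  fixes h :: "nat \<Rightarrow> 'a \<Rightarrow> real"
  assumes bd: "\<And>j z. z \<in> A \<Longrightarrow> h j z \<le> B"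
    and tail: "\<And>e. 0 < e \<Longrightarrow> \<exists>J. \<forall>j\<ge>J. \<forall>z\<in>A. h j z \<le> e"
  obtains E where "antimono E" "E \<longlonglongrightarrow> 0" "\<And>j z. z \<in> A \<Longrightarrow> h j z \<le> E j"
proof -
  \<comment> \<open>Taking all indices from \<open>i\<close> on makes the supremum antimonotone; the
    inserted 0 makes it nonnegative and keeps the set nonempty when \<open>A\<close> is
    empty.\<close>
  define S where "S i = insert 0 {h j z | j z. i \<le> j \<and> z \<in> A}" for i
  define E where "E i = Sup (S i)" for i
  have bdd: "bdd_above (S i)" for i
    unfolding bdd_above_def S_def using bd by (intro exI[of _ "max 0 B"]) (auto intro: max.coboundedI2)
  have sub: "S j \<subseteq> S i" if "i \<le> j" for i j
    using that unfolding S_def by force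
  have anti: "antimono E"
    unfolding E_def by (intro antimonoI cSup_subset_mono bdd sub) (auto simp: S_def)
  have nonneg: "0 \<le> E i" for i
    unfolding E_def by (rule cSup_upper[OF _ bdd]) (simp add: S_def)
  have "E \<longlonglongrightarrow> 0"
  proof (rule LIMSEQ_I)
    fix e :: real assume e: "0 < e"
    then obtain J where J: "\<forall>j\<ge>J. \<forall>z\<in>A. h j z \<le> e/2" using tail[of "e/2"] by auto
    have "E J \<le> e/2"
      unfolding E_def by (rule cSup_least) (use J e in \<open>auto simp: S_def\<close>)
    then have "norm (E i - 0) < e" if "J \<le> i" for i
      using antimonoD[OF anti that] nonneg[of i] e by simp
    then show "\<exists>J. \<forall>i\<ge>J. norm (E i - 0) < e" by blast
  qed
  moreover have "h j z \<le> E j" if "z \<in> A" for j z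
    unfolding E_def by (rule cSup_upper[OF _ bdd]) (use that in \<open>auto simp: S_def\<close>)
  ultimately show thesis using that anti by blast
qed

definition tail_sup :: "c0 \<Rightarrow> nat \<Rightarrow> real"
  where "tail_sup x m = (SUP i\<in>{m..}. \<bar>coord x i\<bar>)"

lemma tail_sup_le: "(\<And>i. m \<le> i \<Longrightarrow> \<bar>coord x i\<bar> \<le> B) \<Longrightarrow> tail_sup x m \<le> B"
  unfolding tail_sup_def by (rule cSUP_least) auto

locale c0_rhs = rd_rhs K a d D f M for K a d and D :: "c0 set" and f M +
  fixes p :: "nat \<Rightarrow> real \<Rightarrow> real" and n :: "nat \<Rightarrow> nat" and P Q :: real and \<phi> :: c0
  assumes growth: "\<And>j t x. t \<in> K \<Longrightarrow> x \<in> D \<Longrightarrow> \<bar>coord (f t x) j\<bar> \<le> p j t + Q * tail_sup x (n j)"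
    and p_null: "\<And>t. t \<in> K \<Longrightarrow> (\<lambda>j. p j t) \<longlonglongrightarrow> 0"
    and p_le: "\<And>j t. t \<in> K \<Longrightarrow> p j t \<le> P"
    and n_mono: "mono n" and n_top: "filterlim n at_top sequentially"
    and Q_pos: "0 < Q"
    and f_bound: "\<And>t x. t \<in> K \<Longrightarrow> x \<in> D \<Longrightarrow> norm (f t x) \<le> M"
    and closed_D: "closed D"
    and ball_sub: "\<And>t. t \<in> ts_kappa K \<Longrightarrow> cball \<phi> (M * (t - a)) \<subseteq> D"
begin

text \<open>
  The functions \<open>p j\<close> tend to 0 only pointwise. Equicontinuity in time upgrades this: up to
  \<open>e/2\<close>, it suffices to evaluate them at the finitely many nodes of a partition.
\<close>

lemma rhs_tail:
  assumes e: "0 < e"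
  shows "\<exists>J. \<forall>j\<ge>J. \<forall>t\<in>K. t < d \<longrightarrow> (\<forall>x\<in>D. \<bar>coord (f t x) j\<bar> \<le> e + Q * tail_sup x (n j))"
proof (rule nearly_const_induct[where \<epsilon> = "e/2" and
    P = "\<lambda>c. \<exists>J. \<forall>j\<ge>J. \<forall>t\<in>K. t < c \<longrightarrow> (\<forall>x\<in>D. \<bar>coord (f t x) j\<bar> \<le> e + Q * tail_sup x (n j))"])
  show "0 < e/2" using e by simp
  have "\<not> t < a" if "t \<in> K" for t using that K_sub by force
  then show "\<exists>J. \<forall>j\<ge>J. \<forall>t\<in>K. t < a \<longrightarrow> (\<forall>x\<in>D. \<bar>coord (f t x) j\<bar> \<le> e + Q * tail_sup x (n j))"
    by blast
next
  fix s t assume st: "s \<in> K" "t \<in> K" "s < t" and nc: "nearly_const (e/2) s t"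
    and "\<exists>J. \<forall>j\<ge>J. \<forall>t\<in>K. t < s \<longrightarrow> (\<forall>x\<in>D. \<bar>coord (f t x) j\<bar> \<le> e + Q * tail_sup x (n j))"
  then obtain J1 where J1: "\<And>j \<tau> x. J1 \<le> j \<Longrightarrow> \<tau> \<in> K \<Longrightarrow> \<tau> < s \<Longrightarrow> x \<in> D \<Longrightarrow>
      \<bar>coord (f \<tau> x) j\<bar> \<le> e + Q * tail_sup x (n j)"
    by blast
  obtain J2 where J2: "\<And>j. J2 \<le> j \<Longrightarrow> p j s < e/2"
    using order_tendstoD(2)[OF p_null[OF st(1)], of "e/2"] e unfolding eventually_sequentially by auto
  have "\<bar>coord (f \<tau> x) j\<bar> \<le> e + Q * tail_sup x (n j)"
    if h: "max J1 J2 \<le> j" "\<tau> \<in> K" "\<tau> < t" "x \<in> D" for j \<tau> x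
  proof (cases "\<tau> < s")
    case True then show ?thesis using J1 h by simp
  next
    case False
    \<comment> \<open>With equal states only the oscillation in time enters, so the value of
      \<open>p j\<close> at the node \<open>s\<close> serves the whole step.\<close>
    then have "norm (f \<tau> x - f s x) \<le> e/2"
      using nc h M_nonneg unfolding nearly_const_def by simp
    then have "\<bar>coord (f \<tau> x) j - coord (f s x) j\<bar> \<le> e/2"
      using abs_coord_le_norm[of "f \<tau> x - f s x" j] by (simp add: minus_c0.rep_eq)
    moreover have "\<bar>coord (f s x) j\<bar> \<le> e/2 + Q * tail_sup x (n j)"
      using growth[OF st(1) h(4), of j] J2[of j] h(1) by simp
    ultimately show ?thesis by linarith
  qed
  then show "\<exists>J. \<forall>j\<ge>J. \<forall>\<tau>\<in>K. \<tau> < t \<longrightarrow> (\<forall>x\<in>D. \<bar>coord (f \<tau> x) j\<bar> \<le> e + Q * tail_sup x (n j))"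
    by blast
qed

text \<open>The growth bound is rewritten so that, for states under a multiple of \<open>Y\<close>,
  its two \<open>Y (n j)\<close> terms cancel; \<open>Y (n i) \<le> 2 * Y i\<close> says that the
  inhomogeneous part is nonnegative.\<close>

lemma barrier_exists:
  obtains Y where "antimono Y" "Y \<longlonglongrightarrow> 0" "\<And>i. \<bar>coord \<phi> i\<bar> \<le> Y i" "\<And>i. Y (n i) \<le> 2 * Y i"
    "\<And>j t x. t \<in> K \<Longrightarrow> t < d \<Longrightarrow> x \<in> D \<Longrightarrow>
      \<bar>coord (f t x) j\<bar> \<le> 2 * Q * Y j - Q * Y (n j) + Q * tail_sup x (n j)"
proof -
  obtain E1 where E1: "antimono E1" "E1 \<longlonglongrightarrow> 0"
    "\<And>j z. z \<in> {t \<in> K. t < d} \<times> D \<Longrightarrow> \<bar>coord (f (fst z) (snd z)) j\<bar> - Q * tail_sup (snd z) (n j) \<le> E1 j"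
  proof (rule uniform_tail_majorant)
    fix j and z :: "real \<times> c0" assume "z \<in> {t \<in> K. t < d} \<times> D"
    then show "\<bar>coord (f (fst z) (snd z)) j\<bar> - Q * tail_sup (snd z) (n j) \<le> P"
      using growth[of "fst z" "snd z" j] p_le[of "fst z" j] by force
  next
    fix e :: real assume "0 < e"
    from rhs_tail[OF this] obtain J where J: "\<And>j t x. J \<le> j \<Longrightarrow> t \<in> K \<Longrightarrow> t < d \<Longrightarrow> x \<in> D \<Longrightarrow>
      \<bar>coord (f t x) j\<bar> \<le> e + Q * tail_sup x (n j)" by blast
    then show "\<exists>J. \<forall>j\<ge>J. \<forall>z\<in>{t \<in> K. t < d} \<times> D.
        \<bar>coord (f (fst z) (snd z)) j\<bar> - Q * tail_sup (snd z) (n j) \<le> e"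
      by (intro exI[of _ J]) (force simp: algebra_simps)
  qed blast
  obtain E2 where E2: "antimono E2" "E2 \<longlonglongrightarrow> 0" "\<And>j z. z \<in> {()} \<Longrightarrow> \<bar>coord \<phi> j\<bar> \<le> E2 j"
  proof (rule uniform_tail_majorant[where h = "\<lambda>j z. \<bar>coord \<phi> j\<bar>" and A = "{()}" and B = "norm \<phi>"])
    fix e :: real assume "0 < e"
    then have "\<forall>\<^sub>F j in sequentially. \<bar>coord \<phi> j\<bar> < e"
      using tendstoD[OF coord_tendsto_0[of \<phi>], of e] by (simp add: dist_real_def)
    then show "\<exists>J. \<forall>j\<ge>J. \<forall>z\<in>{()}. \<bar>coord \<phi> j\<bar> \<le> e"
      unfolding eventually_sequentially by (meson less_imp_le)
  qed (use abs_coord_le_norm in auto)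
  \<comment> \<open>As \<open>2 * Q * Y j - Q * Y (n j) = 2 * Q * E j\<close>, dividing
    \<open>E1\<close> by \<open>2 * Q\<close> makes this difference dominate \<open>E1 j\<close>,
    while \<open>E2\<close> puts the initial value under \<open>Y\<close>.\<close>
  define E where "E j = E1 j / (2 * Q) + E2 j" for j
  have nonneg: "0 \<le> E1 j" "0 \<le> E2 j" for j
    using decseq_ge[OF E1(1,2)] decseq_ge[OF E2(1,2)] by auto
  have "antimono E"
    unfolding E_def using E1(1) E2(1) Q_pos
    by (intro antimonoI add_mono divide_right_mono) (auto simp: antimono_def)
  moreover have "E \<longlonglongrightarrow> 0"
  proof -
    have "(\<lambda>j. E1 j / (2 * Q) + E2 j) \<longlonglongrightarrow> 0 / (2 * Q) + 0"
      using Q_pos by (intro tendsto_intros E1 E2) auto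
    then show ?thesis by (simp add: E_def[abs_def])
  qed
  ultimately obtain Y where Y: "antimono Y" "Y \<longlonglongrightarrow> 0" "\<And>j. Y j = E j + Y (n j) / 2" "\<And>j. E j \<le> Y j"
    using antimono_delay_majorant[OF _ _ n_mono n_top] by metis
  show thesis
  proof (rule that[OF Y(1,2)])
    show "\<bar>coord \<phi> i\<bar> \<le> Y i" for i
    proof -
      have "0 \<le> E1 i / (2 * Q)" using nonneg Q_pos by simp
      then show ?thesis using E2(3)[of "()" i] Y(4)[of i] by (simp add: E_def)
    qed
  next
    have "0 \<le> E i" for i using nonneg Q_pos by (simp add: E_def)
    then show "Y (n i) \<le> 2 * Y i" for i using Y(3)[of i] by (smt (verit) field_sum_of_halves)
  next
    fix j t x assume h: "t \<in> K" "t < d" "x \<in> D"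
    have "2 * Q * Y j - Q * Y (n j) = 2 * Q * E j"
      using Y(3)[of j] by (simp add: field_simps)
    also have "\<dots> = E1 j + 2 * Q * E2 j" using Q_pos by (simp add: E_def field_simps)
    finally have "E1 j \<le> 2 * Q * Y j - Q * Y (n j)" using nonneg Q_pos by simp
    then show "\<bar>coord (f t x) j\<bar> \<le> 2 * Q * Y j - Q * Y (n j) + Q * tail_sup x (n j)"
      using E1(3)[of "(t, x)" j] h by simp
  qed
qed

theorem solution_exists: "\<exists>u. ivp_solution K a D \<phi> f u"
proof -
  obtain Y where Y: "antimono Y" "Y \<longlonglongrightarrow> 0" "\<And>i. \<bar>coord \<phi> i\<bar> \<le> Y i" "\<And>i. Y (n i) \<le> 2 * Y i"
    "\<And>j t x. t \<in> K \<Longrightarrow> t < d \<Longrightarrow> x \<in> D \<Longrightarrow>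
      \<bar>coord (f t x) j\<bar> \<le> 2 * Q * Y j - Q * Y (n j) + Q * tail_sup x (n j)"
    using barrier_exists by metis
  have Y0: "0 \<le> Y i" for i using Y(3)[of i] by linarith
  define g where "g t = exp (2 * Q * (t - a))" for t
  have g1: "1 \<le> g t" if "t \<in> K" for t using that K_sub Q_pos by (auto simp: g_def)
  have gmono: "g s \<le> g t" if "s \<le> t" for s t using that Q_pos by (simp add: g_def)
  define X where "X t = {x. norm (x - \<phi>) \<le> M * (t - a) \<and> (\<forall>i. \<bar>coord x i\<bar> \<le> Y i * g t)}" for t
  have XD: "X t \<subseteq> D" if "t \<in> ts_kappa K" for t
    using ball_sub[OF that] by (auto simp: X_def dist_norm norm_minus_commute)
  have step: "x + (t - s) *\<^sub>R f s x \<in> X t"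
    if st: "s \<in> K" "t \<in> K" "s < t" and x: "x \<in> X s" for s t x
  proof -
    have sd: "s < d" using st K_sub by auto
    have xD: "x \<in> D" using XD[OF kappaI[OF st(1) sd]] x by blast
    have "norm (x + (t - s) *\<^sub>R f s x - \<phi>) \<le> norm (x - \<phi>) + norm ((t - s) *\<^sub>R f s x)"
      using norm_triangle_ineq[of "x - \<phi>" "(t - s) *\<^sub>R f s x"] by (simp add: algebra_simps)
    also have "\<dots> \<le> M * (s - a) + (t - s) * M"
      using x f_bound[OF st(1) xD] st by (intro add_mono) (auto simp: X_def mult_left_mono)
    finally have 1: "norm (x + (t - s) *\<^sub>R f s x - \<phi>) \<le> M * (t - a)" by (simp add: algebra_simps)
    have 2: "\<bar>coord (x + (t - s) *\<^sub>R f s x) i\<bar> \<le> Y i * g t" for i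
    proof -
      have "tail_sup x (n i) \<le> Y (n i) * g s"
      proof (rule tail_sup_le)
        fix m assume "n i \<le> m"
        then have "Y m * g s \<le> Y (n i) * g s"
          using antimonoD[OF Y(1)] g1[OF st(1)] by (intro mult_right_mono) auto
        moreover have "\<bar>coord x m\<bar> \<le> Y m * g s" using x by (simp add: X_def)
        ultimately show "\<bar>coord x m\<bar> \<le> Y (n i) * g s" by linarith
      qed
      then have "Q * tail_sup x (n i) \<le> Q * Y (n i) * g s"
        using Q_pos by (simp add: mult.assoc)
      then have "\<bar>coord (f s x) i\<bar> \<le> (2 * Q * Y i - Q * Y (n i)) * 1 + Q * Y (n i) * g s"
        using Y(5)[OF st(1) sd xD, of i] by simp
      \<comment> \<open>A nonnegative term may be multiplied by \<open>g s\<close>, which is at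
        least 1; this is what lets the \<open>Y (n i)\<close> terms cancel.\<close>
      also have "\<dots> \<le> (2 * Q * Y i - Q * Y (n i)) * g s + Q * Y (n i) * g s"
      proof -
        have "0 \<le> 2 * Q * Y i - Q * Y (n i)"
          using mult_left_mono[OF Y(4)[of i], of Q] Q_pos by simp
        then show ?thesis using g1[OF st(1)] by (intro add_right_mono mult_left_mono)
      qed
      finally have fb: "\<bar>coord (f s x) i\<bar> \<le> 2 * Q * Y i * g s" by (simp add: algebra_simps)
      have "\<bar>coord (x + (t - s) *\<^sub>R f s x) i\<bar> \<le> \<bar>coord x i\<bar> + (t - s) * \<bar>coord (f s x) i\<bar>"
        using st abs_triangle_ineq[of "coord x i" "(t - s) * coord (f s x) i"]
        by (simp add: plus_c0.rep_eq scaleR_c0.rep_eq abs_mult)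
      also have "\<dots> \<le> Y i * g s + (t - s) * (2 * Q * Y i * g s)"
        using x fb st by (intro add_mono mult_left_mono) (auto simp: X_def)
      also have "\<dots> = Y i * (g s * (1 + 2 * Q * (t - s)))" by (simp add: algebra_simps)
      \<comment> \<open>An Euler step for linear growth stays below the exponential with the same
        rate, whatever the step length.\<close>
      also have "\<dots> \<le> Y i * (g s * exp (2 * Q * (t - s)))"
        using Y0 g1[OF st(1)] by (intro mult_left_mono exp_ge_add_one_self) auto
      also have "g s * exp (2 * Q * (t - s)) = g t"
        by (simp add: g_def algebra_simps flip: exp_add)
      finally show ?thesis .
    qed
    show ?thesis using 1 2 by (simp add: X_def)
  qed
  interpret euler_tube K a d D f M X \<phi>
  proof
    show "\<phi> \<in> X a" using Y(3) by (simp add: X_def g_def)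
  qed (use XD step f_bound kappaI in blast)+
  define \<epsilon> where "\<epsilon> k = inverse (real (Suc k))" for k
  have "\<forall>k. \<exists>u. approx_sol (\<epsilon> k) d u" using approx_sol_exists by (simp add: \<epsilon>_def)
  then obtain v where v: "\<And>k. approx_sol (\<epsilon> k) d (v k)" by metis
  have "(\<lambda>i. Y i * g d) \<longlonglongrightarrow> 0" using tendsto_mult_left_zero[OF Y(2)] by simp
  moreover have "\<bar>coord (v k t) i\<bar> \<le> Y i * g d" if t: "t \<in> K" for k t i
  proof -
    have "\<bar>coord (v k t) i\<bar> \<le> Y i * g t" using approx_sol_in_tube[OF v t] by (simp add: X_def)
    also have "\<dots> \<le> Y i * g d" using gmono[of t d] t K_sub Y0 by (intro mult_left_mono) auto
    finally show ?thesis .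
  qed
  moreover have "norm (v k s - v k t) \<le> M * dist s t" if "s \<in> K" "t \<in> K" for k s t
    using approx_sol_lipschitz[OF v that(2,1)] by (simp add: dist_real_def)
  ultimately obtain r u where r: "strict_mono r" and u: "\<And>t. t \<in> K \<Longrightarrow> (\<lambda>k. v (r k) t) \<longlonglongrightarrow> u t"
    using c0_equilipschitz_subsequence[of K v M "\<lambda>i. Y i * g d"] M_nonneg by metis
  interpret euler_limit K a d D f M X \<phi> "\<epsilon> \<circ> r" "v \<circ> r" u
  proof
    show "(\<epsilon> \<circ> r) \<longlonglongrightarrow> 0"
      unfolding \<epsilon>_def[abs_def] by (rule LIMSEQ_subseq_LIMSEQ[OF LIMSEQ_inverse_real_of_nat r])
  qed (use closed_D v u in auto)
  show ?thesis using limit_solution by blast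
qed

end

section \<open>The local solution on \<open>[a, \<sigma>(b\<^sup>\<star>)]\<close>\<close>

text \<open>Some partition neighbourhood contains \<open>c\<close>. If \<open>c\<close> is not its
  centre \<open>\<tau> j\<close>, a smaller neighbourhood of \<open>c\<close> stays on one side of
  \<open>\<tau> j\<close>, so the case condition at \<open>\<tau> j\<close> holds
  automatically.\<close>

lemma rd_equicontinuous_local:
  assumes eq: "uniformly_rd_equicontinuous T a b Y" and c: "c \<in> ts_interval T a b" and e: "0 < \<epsilon>"
  shows "\<exists>\<eta>>0. \<forall>s\<in>ts_interval T a b. \<forall>t\<in>ts_interval T a b. \<forall>u\<in>Y.
    \<bar>s - c\<bar> < \<eta> \<longrightarrow> \<bar>t - c\<bar> < \<eta> \<longrightarrow>
    right_dense (ts_interval T a b) c \<or> s < c \<and> t < c \<or> c \<le> s \<and> c \<le> t \<longrightarrow> norm (u s - u t) < \<epsilon>"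
proof -
  let ?I = "ts_interval T a b"
  obtain m :: nat and \<delta> \<tau> where cover: "?I \<subseteq> (\<Union>i\<in>{1..m}. ts_nbhd ?I (\<delta> i) (\<tau> i))"
    and pos: "\<forall>i\<in>{1..m}. 0 < \<delta> i \<and> \<tau> i \<in> ?I"
    and osc: "\<forall>u\<in>Y. \<forall>j\<in>{1..m}. \<forall>s\<in>ts_nbhd ?I (\<delta> j) (\<tau> j). \<forall>t\<in>ts_nbhd ?I (\<delta> j) (\<tau> j).
      right_dense ?I (\<tau> j) \<or> (s < \<tau> j \<and> t < \<tau> j) \<or> (\<tau> j \<le> s \<and> \<tau> j \<le> t) \<longrightarrow> norm (u s - u t) < \<epsilon>"
    using eq[unfolded uniformly_rd_equicontinuous_def Let_def, THEN spec, THEN mp, OF e]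
    by (elim exE conjE) (rule that)
  obtain j where j: "j \<in> {1..m}" "c \<in> ts_nbhd ?I (\<delta> j) (\<tau> j)" using cover c by blast
  show ?thesis
  proof (cases "c = \<tau> j")
    case True
    show ?thesis
    proof (intro exI[of _ "\<delta> j"] conjI ballI impI)
      show "0 < \<delta> j" using pos j(1) by blast
    next
      fix s t u assume "s \<in> ?I" "t \<in> ?I" "u \<in> Y" "\<bar>s - c\<bar> < \<delta> j" "\<bar>t - c\<bar> < \<delta> j"
        "right_dense ?I c \<or> s < c \<and> t < c \<or> c \<le> s \<and> c \<le> t"
      moreover then have "s \<in> ts_nbhd ?I (\<delta> j) (\<tau> j)" "t \<in> ts_nbhd ?I (\<delta> j) (\<tau> j)"
        using True by (auto simp: ts_nbhd_def)
      ultimately show "norm (u s - u t) < \<epsilon>" using osc[rule_format, OF _ j(1)] True by blast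
    qed
  next
    case False
    define \<eta> where "\<eta> = min (\<delta> j - \<bar>c - \<tau> j\<bar>) \<bar>c - \<tau> j\<bar>"
    have "norm (u s - u t) < \<epsilon>"
      if h: "s \<in> ?I" "t \<in> ?I" "u \<in> Y" "\<bar>s - c\<bar> < \<eta>" "\<bar>t - c\<bar> < \<eta>" for s t u
    proof (rule osc[rule_format, OF h(3) j(1)])
      have *: "\<bar>r - c\<bar> < \<delta> j - \<bar>c - \<tau> j\<bar>" "\<bar>r - c\<bar> < \<bar>c - \<tau> j\<bar>" if "\<bar>r - c\<bar> < \<eta>" for r
        using that by (auto simp: \<eta>_def)
      show "s \<in> ts_nbhd ?I (\<delta> j) (\<tau> j)" "t \<in> ts_nbhd ?I (\<delta> j) (\<tau> j)"
        using *(1)[OF h(4)] *(1)[OF h(5)] h(1,2) unfolding ts_nbhd_def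
        by (auto simp: abs_if split: if_splits)
      show "right_dense ?I (\<tau> j) \<or> (s < \<tau> j \<and> t < \<tau> j) \<or> (\<tau> j \<le> s \<and> \<tau> j \<le> t)"
        using *(2)[OF h(4)] *(2)[OF h(5)] by (auto simp: abs_if split: if_splits)
    qed
    moreover have "\<eta> > 0" using j(2) False by (auto simp: \<eta>_def ts_nbhd_def abs_if)
    ultimately show ?thesis by blast
  qed
qed

theorem theorem11:
  fixes T :: "real set" and a b \<beta> P Q M bstar :: real
    and \<phi> :: c0 and f :: "real \<Rightarrow> c0 \<Rightarrow> c0"
    and p :: "nat \<Rightarrow> real \<Rightarrow> real" and n :: "nat \<Rightarrow> nat"
  assumes "time_scale T" and "a \<in> T" and "b \<in> T" and "a \<le> b"
    and "0 < \<beta>"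
    and "\<And>j. rd_continuous (ts_interval T a b) (p j)"
    and "\<And>j t. t \<in> ts_interval T a b \<Longrightarrow> 0 \<le> p j t"
    and "mono n" and "filterlim n at_top sequentially"
    and "uniformly_rd_equicontinuous T a b ((\<lambda>x t. f t x) ` cball \<phi> \<beta>)"
    and "uniformly_equicontinuous_on (cball \<phi> \<beta>) (f ` ts_interval T a b)"
    and "0 < Q"
    and "\<And>j t x. t \<in> ts_interval T a b \<Longrightarrow> x \<in> cball \<phi> \<beta> \<Longrightarrow>
           \<bar>coord (f t x) j\<bar> \<le> p j t + Q * (SUP i\<in>{n j..}. \<bar>coord x i\<bar>)"
    and "\<And>t. t \<in> ts_interval T a b \<Longrightarrow> (\<lambda>j. p j t) \<longlonglongrightarrow> 0"
    and "0 < P"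
    and "\<And>j t. t \<in> ts_interval T a b \<Longrightarrow> p j t \<le> P"
    and "M = P + Q * (norm \<phi> + \<beta>)"
    and "bstar = ts_Sup (ts_interval T a b)
           {s \<in> ts_interval T a b. forward_jump (ts_interval T a b) s \<le> min b (a + \<beta> / M)}"
  shows "bstar \<in> ts_interval T a b \<and>
         (\<exists>u. ivp_solution (ts_interval T a (forward_jump (ts_interval T a b) bstar))
                a (cball \<phi> \<beta>) \<phi> f u)"
proof -
  note T = assms(1-4) and \<beta> = assms(5) and n = assms(8,9) and equi_t = assms(10) and equi_x = assms(11)
    and Q = assms(12) and growth = assms(13) and p_null = assms(14) and P = assms(15) and p_le = assms(16)
    and M_def = assms(17) and bstar_def = assms(18)
  define I where "I = ts_interval T a b"
  have M: "0 < M" using P Q \<beta> unfolding M_def by (simp add: add_pos_nonneg)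
  interpret I: compact_ts I a b
    by unfold_locales (use T in \<open>auto simp: I_def time_scale_def\<close>)
  define S where "S = {s \<in> I. forward_jump I s \<le> min b (a + \<beta> / M)}"
  \<comment> \<open>\<open>S\<close> is empty when the forward jump of \<open>a\<close> already
    exceeds the bound; the default supremum is then the minimum \<open>a\<close>.\<close>
  have bstar: "bstar = (if S = {} then a else Sup S)"
    unfolding bstar_def ts_Sup_def I_def[symmetric] S_def[symmetric] I.Inf_K by (rule refl)
  have bI: "bstar \<in> I"
  proof (cases "S = {}")
    case True then show ?thesis using bstar I.a_in by simp
  next
    case False
    then have "Sup S \<in> closure S" by (intro closure_contains_Sup I.bdd_K) (auto simp: S_def)
    also have "closure S \<subseteq> I" using I.closed_K by (intro closure_minimal) (auto simp: S_def)
    finally show ?thesis using bstar False by simp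
  qed
  have b_le: "bstar \<le> a + \<beta> / M"
  proof (cases "S = {}")
    case True then show ?thesis using bstar M \<beta> by simp
  next
    case False
    then have "Sup S \<le> a + \<beta> / M"
      using I.forward_jump_ge by (intro cSup_least) (fastforce simp: S_def)+
    then show ?thesis using bstar False by simp
  qed
  define d where "d = forward_jump I bstar"
  have dI: "d \<in> I" and bd: "bstar \<le> d"
    unfolding d_def by (rule I.forward_jump_in[OF bI], rule I.forward_jump_ge[OF bI])
  have gap: "d \<le> s" if "s \<in> I" "bstar < s" for s
    using I.forward_jump_le[OF that] by (simp add: d_def)
  define K where "K = ts_interval T a d"
  have K_eq: "K = I \<inter> {..d}" using dI by (auto simp: K_def I_def)
  interpret K: compact_ts K a d
    by unfold_locales (use I.closed_K I.a_in I.K_sub dI in \<open>auto simp: K_eq intro: closed_Int\<close>)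
  \<comment> \<open>If \<open>bstar < d\<close>, then \<open>d\<close> is a left-scattered maximum
    of \<open>K\<close> and drops out of \<open>ts_kappa\<close>. With \<open>b_le\<close>, all
    times at which the state must lie in the ball are at most
    \<open>a + \<beta> / M\<close>.\<close>
  have kappa_le: "t \<le> bstar" if t: "t \<in> ts_kappa K" for t
  proof (rule ccontr)
    assume *: "\<not> t \<le> bstar"
    have tK: "t \<in> K" using t K.ts_kappa_subset by blast
    then have td: "t = d" using gap[of t] * by (auto simp: K_eq)
    have ne: "bstar \<in> {s \<in> K. s < t}" using bI bd * td by (auto simp: K_eq)
    have "Sup {s \<in> K. s < t} \<le> bstar"
    proof (rule cSup_least)
      show "x \<le> bstar" if "x \<in> {s \<in> K. s < t}" for x
        using that gap[of x] td by (cases "bstar < x") (auto simp: K_eq)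
    qed (use ne in blast)
    then have "left_scattered K t"
      using ne * by (auto simp: left_scattered_def backward_jump_def ts_Sup_def)
    moreover have "\<forall>s\<in>K. s \<le> t" using td by (simp add: K_eq)
    ultimately show False using t by (auto simp: ts_kappa_def)
  qed
  \<comment> \<open>The origin of \<open>M\<close>: states in the ball have norm at most
    \<open>norm \<phi> + \<beta>\<close>, so (iii) and (v) bound every coordinate of
    \<open>f\<close>.\<close>
  have f_bound: "norm (f t x) \<le> M" if t: "t \<in> I" and x: "x \<in> cball \<phi> \<beta>" for t x
  proof (rule norm_c0_leI)
    fix j
    have "norm x \<le> norm \<phi> + \<beta>"
      using x norm_triangle_ineq4[of \<phi> "\<phi> - x"] by (simp add: dist_norm)
    then have "tail_sup x (n j) \<le> norm \<phi> + \<beta>"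
      using abs_coord_le_norm[of x] by (intro tail_sup_le) (meson order_trans)
    then have "Q * tail_sup x (n j) \<le> Q * (norm \<phi> + \<beta>)" using Q by (intro mult_left_mono) auto
    then show "\<bar>coord (f t x) j\<bar> \<le> M"
      using growth[of t x j] p_le[of t j] t x unfolding M_def tail_sup_def I_def by linarith
  qed
  have osc_K: "\<exists>\<eta>>0. \<forall>s\<in>K. \<forall>t\<in>K. \<forall>x\<in>cball \<phi> \<beta>. \<bar>s - c\<bar> < \<eta> \<longrightarrow> \<bar>t - c\<bar> < \<eta> \<longrightarrow>
      right_dense K c \<or> s < c \<and> t < c \<or> c \<le> s \<and> c \<le> t \<longrightarrow> norm (f s x - f t x) \<le> e"
    if c: "c \<in> K" and e: "0 < e" for c e
  proof (cases "right_dense K c \<longrightarrow> right_dense I c")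
    case True
    have cI: "c \<in> ts_interval T a b" using c by (simp add: K_eq I_def)
    obtain \<eta> where \<eta>: "\<eta> > 0" "\<forall>s\<in>I. \<forall>t\<in>I. \<forall>u\<in>(\<lambda>x t. f t x) ` cball \<phi> \<beta>.
        \<bar>s - c\<bar> < \<eta> \<longrightarrow> \<bar>t - c\<bar> < \<eta> \<longrightarrow>
        right_dense I c \<or> s < c \<and> t < c \<or> c \<le> s \<and> c \<le> t \<longrightarrow> norm (u s - u t) < e"
      using rd_equicontinuous_local[OF equi_t cI e, folded I_def] by (elim exE conjE) (rule that)
    show ?thesis
    proof (intro exI[of _ \<eta>] conjI ballI impI \<eta>(1))
      fix s t x assume h: "s \<in> K" "t \<in> K" "x \<in> cball \<phi> \<beta>" "\<bar>s - c\<bar> < \<eta>" "\<bar>t - c\<bar> < \<eta>"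
        "right_dense K c \<or> s < c \<and> t < c \<or> c \<le> s \<and> c \<le> t"
      have "s \<in> I" "t \<in> I" using h by (auto simp: K_eq)
      then show "norm (f s x - f t x) \<le> e"
        using \<eta>(2)[rule_format, of s t "\<lambda>t. f t x"] h True by force
    qed
  next
    case False
    \<comment> \<open>Cutting \<open>I\<close> at \<open>d\<close> can create right-density only at
      \<open>d\<close>. In that case \<open>bstar < d\<close>, as otherwise the forward jump in
      \<open>I\<close> would fix \<open>d\<close>; the gap then isolates \<open>d\<close> in
      \<open>K\<close> and there is nothing to compare.\<close>
    have "\<not> c < d"
    proof
      assume cd: "c < d"
      have "forward_jump I c \<le> c"
      proof (rule field_le_epsilon)
        fix \<eta> :: real assume "0 < \<eta>"
        then obtain s where s: "s \<in> K" "c < s" "s < c + \<eta>"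
          using K.right_dense_approach[OF c cd] False by blast
        then show "forward_jump I c \<le> c + \<eta>"
          using I.forward_jump_le[of s c] by (auto simp: K_eq)
      qed
      then show False
        using False I.forward_jump_ge[of c] c by (auto simp: right_dense_def K_eq)
    qed
    then have cd: "c = d" using c by (simp add: K_eq)
    then have "bstar \<noteq> d" using False d_def by (auto simp: right_dense_def)
    then have lt: "bstar < d" using bd by simp
    have isolated: "s = d" if "s \<in> K" "\<bar>s - d\<bar> < d - bstar" for s
      using gap[of s] that by (auto simp: K_eq)
    then show ?thesis
    proof (intro exI[of _ "d - bstar"] conjI ballI impI)
      fix s t x assume "s \<in> K" "t \<in> K" "\<bar>s - c\<bar> < d - bstar" "\<bar>t - c\<bar> < d - bstar"
      then have "s = d" "t = d" using isolated cd by auto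
      then show "norm (f s x - f t x) \<le> e" using e by simp
    qed (use lt in simp)
  qed
  have unif_K: "\<exists>\<delta>>0. \<forall>t\<in>K. \<forall>x\<in>cball \<phi> \<beta>. \<forall>y\<in>cball \<phi> \<beta>. norm (x - y) < \<delta> \<longrightarrow> norm (f t x - f t y) \<le> e"
    if e: "0 < e" for e
  proof -
    obtain \<delta> where \<delta>: "\<delta> > 0" "\<forall>g\<in>f ` I. \<forall>x\<in>cball \<phi> \<beta>. \<forall>y\<in>cball \<phi> \<beta>.
        dist x y < \<delta> \<longrightarrow> dist (g x) (g y) < e"
      using equi_x[unfolded uniformly_equicontinuous_on_def, folded I_def, THEN spec, THEN mp, OF e]
      by (elim exE conjE) (rule that)
    show ?thesis
    proof (intro exI[of _ \<delta>] conjI ballI impI \<delta>(1))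
      fix t x y assume h: "t \<in> K" "x \<in> cball \<phi> \<beta>" "y \<in> cball \<phi> \<beta>" "norm (x - y) < \<delta>"
      then have "f t \<in> f ` I" by (auto simp: K_eq)
      then show "norm (f t x - f t y) \<le> e"
        using \<delta>(2)[rule_format, of "f t" x y] h by (simp add: dist_norm)
    qed
  qed
  have ball: "cball \<phi> (M * (t - a)) \<subseteq> cball \<phi> \<beta>" if "t \<in> ts_kappa K" for t
  proof (rule subset_cball)
    have "t - a \<le> \<beta> / M" using kappa_le[OF that] b_le by linarith
    then have "M * (t - a) \<le> M * (\<beta> / M)" using M by (intro mult_left_mono) auto
    then show "M * (t - a) \<le> \<beta>" using M by simp
  qed
  interpret c0_rhs K a d "cball \<phi> \<beta>" f M p n P Q \<phi>
  proof
    show "0 \<le> M" using M by simp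
    show "\<bar>coord (f t x) j\<bar> \<le> p j t + Q * tail_sup x (n j)" if "t \<in> K" "x \<in> cball \<phi> \<beta>" for j t x
      using growth[of t x j] that unfolding tail_sup_def I_def[symmetric] K_eq by blast
    show "closed (cball \<phi> \<beta>)" by simp
  qed (use osc_K unif_K p_null p_le n Q f_bound ball in \<open>auto simp: K_eq I_def\<close>)
  have "\<exists>u. ivp_solution K a (cball \<phi> \<beta>) \<phi> f u" by (rule solution_exists)
  then show ?thesis using bI by (simp add: K_def I_def d_def)
qed

end
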